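(* Let $\mathcal G$ be a connected groupoid with $\mathcal G_0$ finite, $x\in\mathcal G_0$, $\tau(x)=\{\tau_y\}_{y\in\mathcal G_0}$ a transversal for $x$, and $\alpha=(A_g,\alpha_g)_{g\in\mathcal G}$ a unital partial action of $\mathcal G$ on a ring $A$. If $\alpha$ is $\tau(x)$-global, then the map $$\varphi:A\star_\alpha\mathcal G\to(A\star_{\alpha^\ast}\mathcal G_0^2)\star_\theta\mathcal G(x),\qquad a\delta_g\mapsto a\,\delta_{(s(g),t(g))}\,\delta_{g_x}\quad(g\in\mathcal G,\ a\in A_g)$$ (extended additively) is a ring isomorphism, where $\alpha^\ast$ is the global action of $\mathcal G_0^2$ on $A$ and $\theta$ the partial action of $\mathcal G(x)$ on $A\star_{\alpha^\ast}\mathcal G_0^2$ defined in the context.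
   Context: Conventions. Rings are associative, not necessarily unital; ideals are two-sided. A groupoid $\mathcal G$ is a small category in which every morphism is invertible; it is identified with its set of morphisms, and its set of objects $\mathcal G_0$ is identified with the set of identity morphisms. For $g\in\mathcal G$, $s(g)=g^{-1}g$ and $t(g)=gg^{-1}$; $gh$ is defined iff $s(g)=t(h)$. Put $\mathcal G(y,z)=\{g: s(g)=y,\ t(g)=z\}$ and $\mathcal G(x)=\mathcal G(x,x)$ (a group). $\mathcal G$ is connected if $\mathcal G(y,z)\neq\emptyset$ for all $y,z\in\mathcal G_0$. A transversal for $x$ is a family $\tau(x)=\{\tau_y: y\in\mathcal G_0\}$ with $\tau_y\in\mathcal G(x,y)$ and $\tau_x=x$. Put $g_x=\tau_{t(g)}^{-1}g\tau_{s(g)}\in\mathcal G(x)$. A partial action of a groupoid $\mathcal G$ on a ring $A$ is a family $\alpha=(A_g,\alpha_g)_{g\in\mathcal G}$ where, for each $g$, $A_{t(g)}$ is an ideal of $A$, $A_g$ is an ideal of $A_{t(g)}$, $\alpha_g:A_{g^{-1}}\to A_g$ is a ring isomorphism, $\alpha_y=\mathrm{id}_{A_y}$ for $y\in\mathcal G_0$, and $\alpha_{gh}$ extends $\alpha_g\alpha_h$ (defined on $\alpha_h^{-1}(A_{g^{-1}}\cap A_h)$) whenever $s(g)=t(h)$. It is global if $\alpha_g\alpha_h=\alpha_{gh}$ whenever $s(g)=t(h)$. A partial action of a group $H$ on a ring $R$ is the one-object case with the ideal attached to the identity equal to $R$. The partial action is unital if each $A_g$ is a unital ring with identity $1_g$,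 a central idempotent of $A$, so $A_g=A1_g$. It is $\tau(x)$-global if $A_{\tau_y^{-1}}=A_x$ and $A_{\tau_y}=A_y$ for all $y\in\mathcal G_0$. For a unital partial action $\alpha$, the partial skew groupoid ring is $A\star_\alpha\mathcal G=\bigoplus_{g\in\mathcal G}A_g\delta_g$ ($\delta_g$ placeholder symbols) with multiplication determined by $(a\delta_g)(b\delta_h)=a\alpha_g(b1_{g^{-1}})\delta_{gh}$ if $s(g)=t(h)$ and $0$ otherwise, for $a\in A_g$, $b\in A_h$; for a group this is the partial skew group ring. $\mathcal G_0^2=\mathcal G_0\times\mathcal G_0$ is the groupoid with object set $\mathcal G_0$, $s(y,z)=y$, $t(y,z)=z$ and $(y,z)(r,y)=(r,z)$. Assume $\alpha$ is unital and $\tau(x)$-global. The global action $\alpha^\ast=(A^\ast_u,\alpha^\ast_u)_{u\in\mathcal G_0^2}$ of $\mathcal G_0^2$ on $A$ is given by $A^\ast_u=A_{t(u)}$ and $\alpha^\ast_u=\alpha_{\tau_{t(u)}}\circ\alpha_{\tau_{s(u)}^{-1}}:A_{s(u)}\to A_{t(u)}$. Let $C=A\star_{\alpha^\ast}\mathcal G_0^2$. For $h\in\mathcal G(x)$ let $C_h=\bigoplus_{u\in\mathcal G_0^2}\alpha_{\tau_{t(u)}}(A_h)\delta_u$, a unital ideal of $C$ with identity $1'_h=\sum_{z\in\mathcal G_0}\alpha_{\tau_z}(1_h)\delta_{(z,z)}$, and let $\theta_h:C_{h^{-1}}\to C_h$ be the additive map with $\theta_h(\alpha_{\tau_{t(u)}}(a)\delta_u)=\alpha_{\tau_{t(u)}}(\alpha_h(a))\delta_u$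 for $a\in A_{h^{-1}}$, $u\in\mathcal G_0^2$. Then $\theta=(C_h,\theta_h)_{h\in\mathcal G(x)}$ is a partial action of the group $\mathcal G(x)$ on $C$. *)

theory Defs
  imports "HOL-Algebra.AbelCoset"
begin

section \<open>Associative rings, not necessarily unital\<close>

text \<open>
  Rings are carried by the HOL-Algebra record, whose field \<open>one\<close> is ignored throughout:
  no definition below refers to it.
\<close>

locale nonunital_ring = abelian_group R for R (structure) +
  assumes mult_closed: "\<lbrakk>a \<in> carrier R; b \<in> carrier R\<rbrakk> \<Longrightarrow> a \<otimes> b \<in> carrier R"
    and mult_assoc: "\<lbrakk>a \<in> carrier R; b \<in> carrier R; c \<in> carrier R\<rbrakk>
      \<Longrightarrow> (a \<otimes> b) \<otimes> c = a \<otimes> (b \<otimes> c)"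
    and left_distrib: "\<lbrakk>a \<in> carrier R; b \<in> carrier R; c \<in> carrier R\<rbrakk>
      \<Longrightarrow> (a \<oplus> b) \<otimes> c = a \<otimes> c \<oplus> b \<otimes> c"
    and right_distrib: "\<lbrakk>a \<in> carrier R; b \<in> carrier R; c \<in> carrier R\<rbrakk>
      \<Longrightarrow> a \<otimes> (b \<oplus> c) = a \<otimes> b \<oplus> a \<otimes> c"

definition two_sided_ideal :: "'a set \<Rightarrow> ('a, 'm) ring_scheme \<Rightarrow> bool" where
  "two_sided_ideal I R \<longleftrightarrow> additive_subgroup I R \<and>
     (\<forall>a\<in>I. \<forall>r\<in>carrier R. r \<otimes>\<^bsub>R\<^esub> a \<in> I \<and> a \<otimes>\<^bsub>R\<^esub> r \<in> I)"

locale ring_isomorphism = R: nonunital_ring R + S: nonunital_ring S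
    for R (structure) and S (structure) +
  fixes f
  assumes bij: "bij_betw f (carrier R) (carrier S)"
    and hom_add: "\<lbrakk>a \<in> carrier R; b \<in> carrier R\<rbrakk> \<Longrightarrow> f (a \<oplus>\<^bsub>R\<^esub> b) = f a \<oplus>\<^bsub>S\<^esub> f b"
    and hom_mult: "\<lbrakk>a \<in> carrier R; b \<in> carrier R\<rbrakk> \<Longrightarrow> f (a \<otimes>\<^bsub>R\<^esub> b) = f a \<otimes>\<^bsub>S\<^esub> f b"

definition is_identity_of :: "('a, 'm) ring_scheme \<Rightarrow> 'a set \<Rightarrow> 'a \<Rightarrow> bool" where
  "is_identity_of R I e \<longleftrightarrow> e \<in> I \<and> (\<forall>a\<in>I. e \<otimes>\<^bsub>R\<^esub> a = a \<and> a \<otimes>\<^bsub>R\<^esub> e = a)"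

definition identity_of :: "('a, 'm) ring_scheme \<Rightarrow> 'a set \<Rightarrow> 'a" where
  "identity_of R I = (THE e. is_identity_of R I e)"


section \<open>Groupoids\<close>

text \<open>
  A groupoid is given by its set of morphisms; objects are identified with identity morphisms,
  so source and target are morphisms too. The product \<open>g \<cdot> h\<close> is meaningful only if
  \<open>src g = tgt h\<close>.
\<close>

record 'g groupoid =
  Arr :: "'g set"
  source :: "'g \<Rightarrow> 'g" ("src\<index>")
  target :: "'g \<Rightarrow> 'g" ("tgt\<index>")
  cmp :: "'g \<Rightarrow> 'g \<Rightarrow> 'g" (infixl "\<cdot>\<index>" 70)

definition Obj :: "'g groupoid \<Rightarrow> 'g set" where
  "Obj G = src\<^bsub>G\<^esub> ` Arr G"

definition is_inverse :: "'g groupoid \<Rightarrow> 'g \<Rightarrow> 'g \<Rightarrow> bool" where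
  "is_inverse G g h \<longleftrightarrow> h \<in> Arr G \<and> src\<^bsub>G\<^esub> h = tgt\<^bsub>G\<^esub> g \<and> tgt\<^bsub>G\<^esub> h = src\<^bsub>G\<^esub> g \<and>
     h \<cdot>\<^bsub>G\<^esub> g = src\<^bsub>G\<^esub> g \<and> g \<cdot>\<^bsub>G\<^esub> h = tgt\<^bsub>G\<^esub> g"

definition ginv :: "'g groupoid \<Rightarrow> 'g \<Rightarrow> 'g" ("ginv\<index>") where
  "ginv\<^bsub>G\<^esub> g = (THE h. is_inverse G g h)"

locale groupoid =
  fixes G :: "'g groupoid" (structure)
  assumes src_closed: "g \<in> Arr G \<Longrightarrow> src g \<in> Arr G"
    and tgt_closed: "g \<in> Arr G \<Longrightarrow> tgt g \<in> Arr G"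
    and src_src: "g \<in> Arr G \<Longrightarrow> src (src g) = src g"
    and tgt_src: "g \<in> Arr G \<Longrightarrow> tgt (src g) = src g"
    and src_tgt: "g \<in> Arr G \<Longrightarrow> src (tgt g) = tgt g"
    and tgt_tgt: "g \<in> Arr G \<Longrightarrow> tgt (tgt g) = tgt g"
    and cmp_closed: "\<lbrakk>g \<in> Arr G; h \<in> Arr G; src g = tgt h\<rbrakk> \<Longrightarrow> g \<cdot> h \<in> Arr G"
    and src_cmp: "\<lbrakk>g \<in> Arr G; h \<in> Arr G; src g = tgt h\<rbrakk> \<Longrightarrow> src (g \<cdot> h) = src h"
    and tgt_cmp: "\<lbrakk>g \<in> Arr G; h \<in> Arr G; src g = tgt h\<rbrakk> \<Longrightarrow> tgt (g \<cdot> h) = tgt g"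
    and cmp_src: "g \<in> Arr G \<Longrightarrow> g \<cdot> src g = g"
    and tgt_cmp_left: "g \<in> Arr G \<Longrightarrow> tgt g \<cdot> g = g"
    and cmp_assoc: "\<lbrakk>g \<in> Arr G; h \<in> Arr G; k \<in> Arr G; src g = tgt h; src h = tgt k\<rbrakk>
      \<Longrightarrow> (g \<cdot> h) \<cdot> k = g \<cdot> (h \<cdot> k)"
    and ex_inverse: "g \<in> Arr G \<Longrightarrow> \<exists>h. is_inverse G g h"

definition hom_set :: "'g groupoid \<Rightarrow> 'g \<Rightarrow> 'g \<Rightarrow> 'g set" where
  "hom_set G y z = {g \<in> Arr G. src\<^bsub>G\<^esub> g = y \<and> tgt\<^bsub>G\<^esub> g = z}"

definition connected_groupoid :: "'g groupoid \<Rightarrow> bool" where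
  "connected_groupoid G \<longleftrightarrow>
     groupoid G \<and> (\<forall>y\<in>Obj G. \<forall>z\<in>Obj G. hom_set G y z \<noteq> {})"

text \<open>The group \<open>G(x)\<close>, as a one-object groupoid.\<close>

definition isotropy :: "'g groupoid \<Rightarrow> 'g \<Rightarrow> 'g groupoid" where
  "isotropy G x = G\<lparr>Arr := hom_set G x x\<rparr>"

text \<open>
  The groupoid \<open>G\<^sub>0 \<times> G\<^sub>0\<close>, where a pair goes from its first to its second component. Its object
  \<open>y\<close> is represented by the identity morphism \<open>(y, y)\<close>.
\<close>

definition pair_groupoid :: "'g groupoid \<Rightarrow> ('g \<times> 'g) groupoid" where
  "pair_groupoid G =
     \<lparr>Arr = Obj G \<times> Obj G,
      source = (\<lambda>u. (fst u, fst u)),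
      target = (\<lambda>u. (snd u, snd u)),
      cmp = (\<lambda>u v. (fst v, snd u))\<rparr>"

definition transversal :: "'g groupoid \<Rightarrow> 'g \<Rightarrow> ('g \<Rightarrow> 'g) \<Rightarrow> bool" where
  "transversal G x \<tau> \<longleftrightarrow> (\<forall>y\<in>Obj G. \<tau> y \<in> hom_set G x y) \<and> \<tau> x = x"

definition to_isotropy :: "'g groupoid \<Rightarrow> ('g \<Rightarrow> 'g) \<Rightarrow> 'g \<Rightarrow> 'g" where
  "to_isotropy G \<tau> g = ginv\<^bsub>G\<^esub> (\<tau> (tgt\<^bsub>G\<^esub> g)) \<cdot>\<^bsub>G\<^esub> g \<cdot>\<^bsub>G\<^esub> \<tau> (src\<^bsub>G\<^esub> g)"


section \<open>Partial actions and partial skew groupoid rings\<close>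

text \<open>
  The maps \<open>\<alpha> g\<close> are total functions in HOL; only their values on \<open>D (ginv g)\<close> matter.
\<close>

locale partial_action = groupoid G + nonunital_ring A
    for G :: "'g groupoid" and A :: "('a, 'm) ring_scheme" +
  fixes D :: "'g \<Rightarrow> 'a set" and \<alpha> :: "'g \<Rightarrow> 'a \<Rightarrow> 'a"
  assumes ideal_tgt: "g \<in> Arr G \<Longrightarrow> two_sided_ideal (D (tgt\<^bsub>G\<^esub> g)) A"
    and ideal_dom: "g \<in> Arr G \<Longrightarrow> two_sided_ideal (D g) (A\<lparr>carrier := D (tgt\<^bsub>G\<^esub> g)\<rparr>)"
    and iso: "g \<in> Arr G \<Longrightarrow>
      ring_isomorphism (A\<lparr>carrier := D (ginv\<^bsub>G\<^esub> g)\<rparr>) (A\<lparr>carrier := D g\<rparr>) (\<alpha> g)"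
    and act_obj: "\<lbrakk>y \<in> Obj G; a \<in> D y\<rbrakk> \<Longrightarrow> \<alpha> y a = a"
    and act_extends: "\<lbrakk>g \<in> Arr G; h \<in> Arr G; src\<^bsub>G\<^esub> g = tgt\<^bsub>G\<^esub> h;
        a \<in> D (ginv\<^bsub>G\<^esub> h); \<alpha> h a \<in> D (ginv\<^bsub>G\<^esub> g)\<rbrakk>
      \<Longrightarrow> a \<in> D (ginv\<^bsub>G\<^esub> (g \<cdot>\<^bsub>G\<^esub> h)) \<and> \<alpha> (g \<cdot>\<^bsub>G\<^esub> h) a = \<alpha> g (\<alpha> h a)"

locale unital_partial_action = partial_action +
  assumes unital: "g \<in> Arr G \<Longrightarrow>
    \<exists>e. is_identity_of A (D g) e \<and> (\<forall>a\<in>carrier A. e \<otimes>\<^bsub>A\<^esub> a = a \<otimes>\<^bsub>A\<^esub> e)"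

definition transversal_global ::
    "'g groupoid \<Rightarrow> ('g \<Rightarrow> 'a set) \<Rightarrow> 'g \<Rightarrow> ('g \<Rightarrow> 'g) \<Rightarrow> bool" where
  "transversal_global G D x \<tau> \<longleftrightarrow>
     (\<forall>y\<in>Obj G. D (ginv\<^bsub>G\<^esub> (\<tau> y)) = D x \<and> D (\<tau> y) = D y)"

text \<open>
  An element \<open>\<Sum>\<^sub>g a\<^sub>g \<delta>\<^sub>g\<close> is the function \<open>g \<mapsto> a\<^sub>g\<close>, extended by zero outside \<open>Arr G\<close>. In the
  product the index set is cut down to the supports to make it finite, as \<open>finsum\<close> vanishes on
  infinite index sets. For a one-object groupoid this is the partial skew group ring.
\<close>

definition skew_ring :: "'g groupoid \<Rightarrow> ('a, 'm) ring_scheme \<Rightarrow> ('g \<Rightarrow> 'a set) \<Rightarrow>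
    ('g \<Rightarrow> 'a \<Rightarrow> 'a) \<Rightarrow> ('g \<Rightarrow> 'a) ring" where
  "skew_ring G A D \<alpha> =
     \<lparr>carrier = {f. (\<forall>g\<in>Arr G. f g \<in> D g) \<and> (\<forall>g. g \<notin> Arr G \<longrightarrow> f g = \<zero>\<^bsub>A\<^esub>) \<and>
                    finite {g \<in> Arr G. f g \<noteq> \<zero>\<^bsub>A\<^esub>}},
      mult = (\<lambda>f f' k. finsum A
        (\<lambda>(g, h). f g \<otimes>\<^bsub>A\<^esub> \<alpha> g (f' h \<otimes>\<^bsub>A\<^esub> identity_of A (D (ginv\<^bsub>G\<^esub> g))))
        {(g, h). g \<in> Arr G \<and> h \<in> Arr G \<and> src\<^bsub>G\<^esub> g = tgt\<^bsub>G\<^esub> h \<and> g \<cdot>\<^bsub>G\<^esub> h = k \<and>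
                 f g \<noteq> \<zero>\<^bsub>A\<^esub> \<and> f' h \<noteq> \<zero>\<^bsub>A\<^esub>}),
      one = undefined,
      zero = (\<lambda>_. \<zero>\<^bsub>A\<^esub>),
      add = (\<lambda>f f' g. f g \<oplus>\<^bsub>A\<^esub> f' g)\<rparr>"

text \<open>The element \<open>a \<delta>\<^sub>g\<close>.\<close>

definition delta :: "('a, 'm) ring_scheme \<Rightarrow> 'a \<Rightarrow> 'g \<Rightarrow> 'g \<Rightarrow> 'a" where
  "delta A a g = (\<lambda>k. if k = g then a else \<zero>\<^bsub>A\<^esub>)"


section \<open>The global action of the pair groupoid and the action of the isotropy group\<close>

definition star_ideal :: "('g \<Rightarrow> 'a set) \<Rightarrow> 'g \<times> 'g \<Rightarrow> 'a set" where
  "star_ideal D u = D (snd u)"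

definition star_act :: "'g groupoid \<Rightarrow> ('g \<Rightarrow> 'a \<Rightarrow> 'a) \<Rightarrow> ('g \<Rightarrow> 'g) \<Rightarrow> 'g \<times> 'g \<Rightarrow> 'a \<Rightarrow> 'a" where
  "star_act G \<alpha> \<tau> u = \<alpha> (\<tau> (snd u)) \<circ> \<alpha> (ginv\<^bsub>G\<^esub> (\<tau> (fst u)))"

definition star_ring :: "'g groupoid \<Rightarrow> ('a, 'm) ring_scheme \<Rightarrow> ('g \<Rightarrow> 'a set) \<Rightarrow>
    ('g \<Rightarrow> 'a \<Rightarrow> 'a) \<Rightarrow> ('g \<Rightarrow> 'g) \<Rightarrow> ('g \<times> 'g \<Rightarrow> 'a) ring" where
  "star_ring G A D \<alpha> \<tau> = skew_ring (pair_groupoid G) A (star_ideal D) (star_act G \<alpha> \<tau>)"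

definition theta_ideal :: "'g groupoid \<Rightarrow> ('a, 'm) ring_scheme \<Rightarrow> ('g \<Rightarrow> 'a set) \<Rightarrow>
    ('g \<Rightarrow> 'a \<Rightarrow> 'a) \<Rightarrow> ('g \<Rightarrow> 'g) \<Rightarrow> 'g \<Rightarrow> ('g \<times> 'g \<Rightarrow> 'a) set" where
  "theta_ideal G A D \<alpha> \<tau> h =
     {c \<in> carrier (star_ring G A D \<alpha> \<tau>).
        \<forall>u\<in>Arr (pair_groupoid G). c u \<in> \<alpha> (\<tau> (snd u)) ` D h}"

text \<open>
  The \<open>inv_into\<close> term recovers the \<open>a \<in> D (ginv h)\<close> with \<open>c u = \<alpha> (\<tau> (snd u)) a\<close>.
\<close>

definition theta :: "'g groupoid \<Rightarrow> ('a, 'm) ring_scheme \<Rightarrow> ('g \<Rightarrow> 'a set) \<Rightarrow>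
    ('g \<Rightarrow> 'a \<Rightarrow> 'a) \<Rightarrow> ('g \<Rightarrow> 'g) \<Rightarrow> 'g \<Rightarrow> ('g \<times> 'g \<Rightarrow> 'a) \<Rightarrow> ('g \<times> 'g \<Rightarrow> 'a)" where
  "theta G A D \<alpha> \<tau> h c =
     (\<lambda>u. if u \<in> Arr (pair_groupoid G)
          then \<alpha> (\<tau> (snd u)) (\<alpha> h (inv_into (D (ginv\<^bsub>G\<^esub> h)) (\<alpha> (\<tau> (snd u))) (c u)))
          else \<zero>\<^bsub>A\<^esub>)"

definition theta_ring :: "'g groupoid \<Rightarrow> ('a, 'm) ring_scheme \<Rightarrow> ('g \<Rightarrow> 'a set) \<Rightarrow>
    ('g \<Rightarrow> 'a \<Rightarrow> 'a) \<Rightarrow> 'g \<Rightarrow> ('g \<Rightarrow> 'g) \<Rightarrow> ('g \<Rightarrow> 'g \<times> 'g \<Rightarrow> 'a) ring" where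
  "theta_ring G A D \<alpha> x \<tau> =
     skew_ring (isotropy G x) (star_ring G A D \<alpha> \<tau>) (theta_ideal G A D \<alpha> \<tau>) (theta G A D \<alpha> \<tau>)"

text \<open>The element \<open>a \<delta>\<^bsub>(s(g), t(g))\<^esub> \<delta>\<^bsub>g\<^sub>x\<^esub>\<close>, and the additive extension of \<open>a \<delta>\<^sub>g \<mapsto>\<close> this element.\<close>

definition phi_gen :: "'g groupoid \<Rightarrow> ('a, 'm) ring_scheme \<Rightarrow> ('g \<Rightarrow> 'a set) \<Rightarrow>
    ('g \<Rightarrow> 'a \<Rightarrow> 'a) \<Rightarrow> ('g \<Rightarrow> 'g) \<Rightarrow> 'a \<Rightarrow> 'g \<Rightarrow> ('g \<Rightarrow> 'g \<times> 'g \<Rightarrow> 'a)" where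
  "phi_gen G A D \<alpha> \<tau> a g =
     delta (star_ring G A D \<alpha> \<tau>) (delta A a (src\<^bsub>G\<^esub> g, tgt\<^bsub>G\<^esub> g)) (to_isotropy G \<tau> g)"

definition phi :: "'g groupoid \<Rightarrow> ('a, 'm) ring_scheme \<Rightarrow> ('g \<Rightarrow> 'a set) \<Rightarrow>
    ('g \<Rightarrow> 'a \<Rightarrow> 'a) \<Rightarrow> 'g \<Rightarrow> ('g \<Rightarrow> 'g) \<Rightarrow> ('g \<Rightarrow> 'a) \<Rightarrow> ('g \<Rightarrow> 'g \<times> 'g \<Rightarrow> 'a)" where
  "phi G A D \<alpha> x \<tau> f =
     (\<Oplus>\<^bsub>theta_ring G A D \<alpha> x \<tau>\<^esub>g \<in> {g \<in> Arr G. f g \<noteq> \<zero>\<^bsub>A\<^esub>}. phi_gen G A D \<alpha> \<tau> (f g) g)"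

end

theory Submission
  imports Defs
begin

text \<open>
  Write \<open>\<beta>\<^sub>g(b) = \<alpha>\<^sub>g(b 1\<^bsub>g\<^sup>-\<^sup>1\<^esub>)\<close>. The maps \<open>\<beta>\<^sub>g\<close> are additive and multiplicative on all of \<open>A\<close> and
  satisfy \<open>\<beta>\<^sub>g \<beta>\<^sub>h = 1\<^sub>g \<beta>\<^sub>g\<^sub>h\<close>; this makes the partial skew groupoid ring associative. Every arrow is
  uniquely \<open>\<tau>\<^sub>z h \<tau>\<^sub>y\<^sup>-\<^sup>1\<close> with \<open>h\<close> in the isotropy group, so on coefficients the map \<open>\<phi>\<close> is the
  reindexing \<open>(\<phi> f)\<^sub>h(y, z) = f(\<tau>\<^sub>z h \<tau>\<^sub>y\<^sup>-\<^sup>1)\<close>. Since \<open>\<alpha>\<close> is global along \<open>\<tau>\<close>, the ideal of this arrow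
  is \<open>\<alpha>\<^bsub>\<tau>\<^sub>z\<^esub>(A\<^sub>h)\<close>, which makes \<open>\<phi>\<close> bijective, and
  \<open>a \<beta>\<^bsub>\<tau>\<^sub>z\<^esub> \<beta>\<^sub>h \<beta>\<^bsub>\<tau>\<^sub>y\<^sup>-\<^sup>1\<^esub> = a \<beta>\<^bsub>\<tau>\<^sub>z h \<tau>\<^sub>y\<^sup>-\<^sup>1\<^esub>\<close> for \<open>a\<close> in this ideal, which makes it multiplicative. The ring axioms
  of the target are then carried over from the source.
\<close>

section \<open>Finite sums\<close>

lemma (in abelian_monoid) finsum_Sigma:
  assumes "finite I" "\<And>i. i \<in> I \<Longrightarrow> finite (J i)"
    and "\<And>i j. \<lbrakk>i \<in> I; j \<in> J i\<rbrakk> \<Longrightarrow> F i j \<in> carrier G"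
  shows "finsum G (\<lambda>i. finsum G (F i) (J i)) I = finsum G (\<lambda>(i, j). F i j) (Sigma I J)"
  using assms
proof (induction I)
  case empty
  then show ?case by simp
next
  case (insert i I)
  have S: "Sigma (insert i I) J = Pair i ` J i \<union> Sigma I J" by auto
  have row: "finsum G (\<lambda>(i, j). F i j) (Pair i ` J i) = finsum G (F i) (J i)"
    using insert.prems by (subst finsum_reindex) (auto simp: inj_on_def)
  have "finsum G (\<lambda>(i, j). F i j) (Sigma (insert i I) J)
      = finsum G (\<lambda>(i, j). F i j) (Pair i ` J i) \<oplus> finsum G (\<lambda>(i, j). F i j) (Sigma I J)"
    unfolding S using insert by (intro finsum_Un_disjoint) auto
  then show ?case
    using insert by (simp add: row finsum_insert finsum_closed Pi_def)
qed

lemma (in abelian_monoid) finsum_swap: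
  assumes "finite I" "finite J"
    and "\<And>i j. \<lbrakk>i \<in> I; j \<in> J\<rbrakk> \<Longrightarrow> F i j \<in> carrier G"
  shows "finsum G (\<lambda>i. finsum G (F i) J) I = finsum G (\<lambda>j. finsum G (\<lambda>i. F i j) I) J"
  using assms
proof (induction I)
  case empty
  then show ?case by simp
next
  case (insert i I)
  have "finsum G (\<lambda>j. finsum G (\<lambda>i. F i j) (insert i I)) J
      = finsum G (\<lambda>j. F i j \<oplus> finsum G (\<lambda>i. F i j) I) J"
    using insert by (intro finsum_cong') (auto simp: finsum_closed Pi_def)
  also have "\<dots> = finsum G (F i) J \<oplus> finsum G (\<lambda>j. finsum G (\<lambda>i. F i j) I) J"
    using insert by (intro finsum_addf) (auto simp: finsum_closed Pi_def)
  finally show ?case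
    using insert by (simp add: finsum_insert finsum_closed Pi_def)
qed

text \<open>Only additivity on the carriers is asked of \<open>h\<close>, so one lemma serves
  multiplication by a fixed element, \<open>ext_act g\<close>, evaluation of a function at a point,
  and \<open>psi\<close>.\<close>

lemma additive_finsum:
  assumes "abelian_monoid R" "abelian_monoid S" "finite I"
    and "\<And>i. i \<in> I \<Longrightarrow> F i \<in> carrier R"
    and "\<And>a. a \<in> carrier R \<Longrightarrow> h a \<in> carrier S"
    and "h \<zero>\<^bsub>R\<^esub> = \<zero>\<^bsub>S\<^esub>"
    and "\<And>a b. \<lbrakk>a \<in> carrier R; b \<in> carrier R\<rbrakk> \<Longrightarrow> h (a \<oplus>\<^bsub>R\<^esub> b) = h a \<oplus>\<^bsub>S\<^esub> h b"
  shows "h (finsum R F I) = finsum S (\<lambda>i. h (F i)) I"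
proof -
  interpret R: abelian_monoid R by fact
  interpret S: abelian_monoid S by fact
  from assms(3,4) show ?thesis
    by (induction I) (simp_all add: assms(5-7) Pi_def)
qed

section \<open>Nonunital rings\<close>

context nonunital_ring
begin

lemma mult_zero_right: assumes "a \<in> carrier R" shows "a \<otimes> \<zero> = \<zero>"
proof -
  have "a \<otimes> \<zero> \<oplus> a \<otimes> \<zero> = a \<otimes> \<zero>"
    using right_distrib[of a \<zero> \<zero>] assms by simp
  then show ?thesis
    using assms mult_closed by (simp add: add.l_cancel_one)
qed

lemma mult_zero_left: assumes "a \<in> carrier R" shows "\<zero> \<otimes> a = \<zero>"
proof -
  have "\<zero> \<otimes> a \<oplus> \<zero> \<otimes> a = \<zero> \<otimes> a"
    using left_distrib[of \<zero> \<zero> a] assms by simp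
  then show ?thesis
    using assms mult_closed by (simp add: add.l_cancel_one)
qed

lemma mult_finsum_right:
  assumes "finite I" "a \<in> carrier R" "\<And>i. i \<in> I \<Longrightarrow> F i \<in> carrier R"
  shows "a \<otimes> finsum R F I = finsum R (\<lambda>i. a \<otimes> F i) I"
  using assms
  by (intro additive_finsum)
     (auto simp: mult_closed mult_zero_right right_distrib abelian_monoid_axioms)

lemma mult_finsum_left:
  assumes "finite I" "a \<in> carrier R" "\<And>i. i \<in> I \<Longrightarrow> F i \<in> carrier R"
  shows "finsum R F I \<otimes> a = finsum R (\<lambda>i. F i \<otimes> a) I"
  using assms
  by (intro additive_finsum[where h = "\<lambda>b. b \<otimes> a"])
     (auto simp: mult_closed mult_zero_left left_distrib abelian_monoid_axioms)

end

text \<open>Two identities of the same \<open>I\<close> both equal their product, so the description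
  selects whichever identity is exhibited.\<close>

lemma identity_of_eqI:
  assumes "is_identity_of R I e" shows "identity_of R I = e"
  unfolding identity_of_def
  using assms by (intro the_equality) (assumption, metis is_identity_of_def)

section \<open>Groupoids\<close>

context groupoid
begin

lemma inverse_unique:
  assumes "g \<in> Arr G" "is_inverse G g h" "is_inverse G g h'"
  shows "h = h'"
proof -
  have "h = (h' \<cdot> g) \<cdot> h"
    using assms tgt_cmp_left[of h] by (simp add: is_inverse_def)
  also have "\<dots> = h' \<cdot> (g \<cdot> h)"
    using assms by (intro cmp_assoc) (auto simp: is_inverse_def)
  also have "\<dots> = h'"
    using assms cmp_src[of h'] by (simp add: is_inverse_def)
  finally show ?thesis .
qed

lemma is_inverse_ginv: assumes "g \<in> Arr G" shows "is_inverse G g (ginv g)"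
  unfolding ginv_def using ex_inverse[OF assms] inverse_unique[OF assms] by (metis theI)

lemma ginv_eqI: "\<lbrakk>g \<in> Arr G; is_inverse G g h\<rbrakk> \<Longrightarrow> ginv g = h"
  using inverse_unique is_inverse_ginv by blast

lemma ginv_closed [simp]: "g \<in> Arr G \<Longrightarrow> ginv g \<in> Arr G"
  and src_ginv [simp]: "g \<in> Arr G \<Longrightarrow> src (ginv g) = tgt g"
  and tgt_ginv [simp]: "g \<in> Arr G \<Longrightarrow> tgt (ginv g) = src g"
  and ginv_cmp [simp]: "g \<in> Arr G \<Longrightarrow> ginv g \<cdot> g = src g"
  and cmp_ginv [simp]: "g \<in> Arr G \<Longrightarrow> g \<cdot> ginv g = tgt g"
  using is_inverse_ginv by (auto simp: is_inverse_def)

lemma ginv_ginv [simp]: "g \<in> Arr G \<Longrightarrow> ginv (ginv g) = g"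
  by (rule ginv_eqI) (auto simp: is_inverse_def)

declare cmp_closed [simp] src_cmp [simp] tgt_cmp [simp] cmp_src [simp] tgt_cmp_left [simp]
  src_closed [simp] tgt_closed [simp] src_src [simp] src_tgt [simp] tgt_src [simp] tgt_tgt [simp]

lemma tgt_cmp_left' [simp]: "\<lbrakk>g \<in> Arr G; tgt g = y\<rbrakk> \<Longrightarrow> y \<cdot> g = g"
  and cmp_src' [simp]: "\<lbrakk>g \<in> Arr G; src g = y\<rbrakk> \<Longrightarrow> g \<cdot> y = g"
  by auto

lemma ginv_cmp_cancel [simp]:
  "\<lbrakk>g \<in> Arr G; k \<in> Arr G; src g = tgt k\<rbrakk> \<Longrightarrow> ginv g \<cdot> (g \<cdot> k) = k"
  by (subst cmp_assoc[symmetric]) auto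

lemma cmp_ginv_cancel [simp]:
  "\<lbrakk>g \<in> Arr G; k \<in> Arr G; tgt g = tgt k\<rbrakk> \<Longrightarrow> g \<cdot> (ginv g \<cdot> k) = k"
  by (subst cmp_assoc[symmetric]) auto

lemma ginv_of_cmp:
  assumes "g \<in> Arr G" "h \<in> Arr G" "src g = tgt h"
  shows "ginv (g \<cdot> h) = ginv h \<cdot> ginv g"
  using assms by (intro ginv_eqI) (auto simp: is_inverse_def cmp_assoc)

lemma ObjD [simp]:
  assumes "y \<in> Obj G" shows "y \<in> Arr G" "src y = y" "tgt y = y"
  using assms by (auto simp: Obj_def)

lemma ginv_Obj [simp]: "y \<in> Obj G \<Longrightarrow> ginv y = y"
  by (rule ginv_eqI) (auto simp: is_inverse_def)

lemma src_Obj [simp]: "g \<in> Arr G \<Longrightarrow> src g \<in> Obj G"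
  and tgt_Obj [simp]: "g \<in> Arr G \<Longrightarrow> tgt g \<in> Obj G"
  unfolding Obj_def using tgt_closed src_tgt by (metis image_eqI)+

text \<open>A factorization of \<open>k\<close> is determined by its first factor \<open>g\<close>,
  the second being \<open>ginv g \<cdot> k\<close>. The summand \<open>P\<close> stays abstract
  because the products over \<open>G\<close>, over the pair groupoid and over the isotropy group are
  all reduced to this form.\<close>

lemma finsum_factorizations:
  assumes "abelian_monoid R" "k \<in> Arr G" "finite S" "S \<subseteq> Arr G"
    and closed: "\<And>g h. \<lbrakk>g \<in> Arr G; h \<in> Arr G; src g = tgt h\<rbrakk> \<Longrightarrow> P g h \<in> carrier R"
    and left0: "\<And>g h. \<lbrakk>g \<in> Arr G; h \<in> Arr G; src g = tgt h; f g = z\<rbrakk> \<Longrightarrow> P g h = \<zero>\<^bsub>R\<^esub>"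
    and right0: "\<And>g h. \<lbrakk>g \<in> Arr G; h \<in> Arr G; src g = tgt h; f' h = z\<rbrakk> \<Longrightarrow> P g h = \<zero>\<^bsub>R\<^esub>"
    and supp: "\<And>g. \<lbrakk>g \<in> Arr G; g \<notin> S\<rbrakk> \<Longrightarrow> f g = z"
  shows "finsum R (\<lambda>(g, h). P g h)
      {(g, h). g \<in> Arr G \<and> h \<in> Arr G \<and> src g = tgt h \<and> g \<cdot> h = k \<and> f g \<noteq> z \<and> f' h \<noteq> z}
    = finsum R (\<lambda>g. P g (ginv g \<cdot> k)) {g \<in> S. tgt g = tgt k}"
proof -
  interpret R: abelian_monoid R by fact
  \<comment> \<open>\<open>?T\<close> still demands nonzero factors; the remaining elements of
    \<open>S\<close> with the right target are added later, their terms being zero by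
    \<open>left0\<close> or \<open>right0\<close>.\<close>
  let ?T = "{g \<in> S. tgt g = tgt k \<and> f g \<noteq> z \<and> f' (ginv g \<cdot> k) \<noteq> z}"
  have "{(g, h). g \<in> Arr G \<and> h \<in> Arr G \<and> src g = tgt h \<and> g \<cdot> h = k \<and> f g \<noteq> z \<and> f' h \<noteq> z}
      = (\<lambda>g. (g, ginv g \<cdot> k)) ` ?T" (is "?L = ?R")
  proof
    show "?L \<subseteq> ?R" using supp by (auto simp: image_iff) blast
    show "?R \<subseteq> ?L" using assms(2,4) by (auto simp: subset_iff)
  qed
  moreover have "finsum R (\<lambda>(g, h). P g h) ((\<lambda>g. (g, ginv g \<cdot> k)) ` ?T)
      = finsum R (\<lambda>g. P g (ginv g \<cdot> k)) ?T"
    using assms(2,4) by (subst R.finsum_reindex) (auto simp: inj_on_def subset_iff intro!: closed)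
  moreover have "\<dots> = finsum R (\<lambda>g. P g (ginv g \<cdot> k)) {g \<in> S. tgt g = tgt k}"
    using assms(2-4)
    by (intro R.add.finprod_mono_neutral_cong_left)
       (auto simp: subset_iff intro!: closed intro: left0 right0)
  ultimately show ?thesis by simp
qed

end

lemma groupoid_pair_groupoid:
  assumes "groupoid G" shows "groupoid (pair_groupoid G)"
  by unfold_locales (auto simp: pair_groupoid_def is_inverse_def)

lemma ginv_pair_groupoid:
  assumes "y \<in> Obj G" "z \<in> Obj G" "groupoid G"
  shows "ginv\<^bsub>pair_groupoid G\<^esub> (y, z) = (z, y)"
  using assms by (intro groupoid.ginv_eqI groupoid_pair_groupoid)
    (auto simp: pair_groupoid_def is_inverse_def)

text \<open>Inverses are definite descriptions that depend on the set of arrows, so they must be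
  compared: the inverse in \<open>G\<close> of a loop at \<open>x\<close> is again a loop at
  \<open>x\<close>.\<close>

lemma groupoid_isotropy:
  assumes "groupoid G" "x \<in> Obj G"
  shows "groupoid (isotropy G x)"
    and "g \<in> hom_set G x x \<Longrightarrow> ginv\<^bsub>isotropy G x\<^esub> g = ginv\<^bsub>G\<^esub> g"
proof -
  interpret groupoid G by fact
  have inv: "is_inverse (isotropy G x) g (ginv\<^bsub>G\<^esub> g)" if "g \<in> hom_set G x x" for g
    using that by (auto simp: isotropy_def hom_set_def is_inverse_def)
  show *: "groupoid (isotropy G x)"
  proof (unfold_locales, goal_cases)
    \<comment> \<open>Goal 13 is the existence of inverses, the last axiom of the locale.\<close>
    case (13 g)
    then show ?case using inv by (auto simp: isotropy_def)
  qed (use assms(2) in \<open>auto simp: isotropy_def hom_set_def cmp_assoc\<close>)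
  show "ginv\<^bsub>isotropy G x\<^esub> g = ginv\<^bsub>G\<^esub> g" if "g \<in> hom_set G x x"
    using that by (intro groupoid.ginv_eqI[OF *] inv) (simp_all add: isotropy_def)
qed

section \<open>Unital partial actions\<close>

context unital_partial_action
begin

section \<open>The ideals and their identities\<close>

abbreviation idem :: "'a \<Rightarrow> 'b" where
  "idem g \<equiv> identity_of A (D g)"

lemma idem_identity: assumes "g \<in> Arr G"
  shows "is_identity_of A (D g) (idem g)"
    and "a \<in> carrier A \<Longrightarrow> idem g \<otimes>\<^bsub>A\<^esub> a = a \<otimes>\<^bsub>A\<^esub> idem g"
  using unital[OF assms] identity_of_eqI by metis+

lemma idem_in_D: "g \<in> Arr G \<Longrightarrow> idem g \<in> D g"
  and idem_left: "\<lbrakk>g \<in> Arr G; a \<in> D g\<rbrakk> \<Longrightarrow> idem g \<otimes>\<^bsub>A\<^esub> a = a"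
  and idem_right [simp]: "\<lbrakk>g \<in> Arr G; a \<in> D g\<rbrakk> \<Longrightarrow> a \<otimes>\<^bsub>A\<^esub> idem g = a"
  using idem_identity(1) by (auto simp: is_identity_of_def)

lemma tgt_additive: "g \<in> Arr G \<Longrightarrow> additive_subgroup (D (tgt\<^bsub>G\<^esub> g)) A"
  using ideal_tgt by (auto simp: two_sided_ideal_def)

lemma D_subset_tgt: "g \<in> Arr G \<Longrightarrow> D g \<subseteq> D (tgt\<^bsub>G\<^esub> g)"
  using ideal_dom additive_subgroup.a_subset by (fastforce simp: two_sided_ideal_def)

lemma D_carrier: "\<lbrakk>g \<in> Arr G; a \<in> D g\<rbrakk> \<Longrightarrow> a \<in> carrier A"
  using D_subset_tgt tgt_additive additive_subgroup.a_subset by fastforce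

lemma idem_closed [simp]: "g \<in> Arr G \<Longrightarrow> idem g \<in> carrier A"
  using D_carrier idem_in_D by blast

text \<open>A priori \<open>D g\<close> is an ideal only of \<open>D (tgt g)\<close>. Hence the
  double multiplication: the first factor \<open>idem g\<close> moves \<open>a\<close> into
  \<open>D (tgt g)\<close>, an ideal of \<open>A\<close>, and the second moves it into
  \<open>D g\<close>. Thus \<open>D g\<close> consists of the elements fixed by
  \<open>idem g\<close>.\<close>

lemma D_I:
  assumes "g \<in> Arr G" "a \<in> carrier A" "a \<otimes>\<^bsub>A\<^esub> idem g = a"
  shows "a \<in> D g"
proof -
  have "a \<otimes>\<^bsub>A\<^esub> idem g \<in> D (tgt\<^bsub>G\<^esub> g)"
    using ideal_tgt[OF assms(1)] assms(2) subsetD[OF D_subset_tgt idem_in_D, OF assms(1,1)]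
    by (auto simp: two_sided_ideal_def)
  then have "(a \<otimes>\<^bsub>A\<^esub> idem g) \<otimes>\<^bsub>A\<^esub> idem g \<in> D g"
    using ideal_dom[OF assms(1)] assms(1) idem_in_D by (auto simp: two_sided_ideal_def)
  then show ?thesis
    by (simp add: assms(3))
qed

lemma idem_comm:
  "\<lbrakk>g \<in> Arr G; a \<in> carrier A; b \<in> carrier A\<rbrakk> \<Longrightarrow> (a \<otimes>\<^bsub>A\<^esub> idem g) \<otimes>\<^bsub>A\<^esub> b = (a \<otimes>\<^bsub>A\<^esub> b) \<otimes>\<^bsub>A\<^esub> idem g"
  by (simp add: mult_assoc idem_identity(2))

text \<open>By the membership test \<open>D_I\<close>, the set \<open>D g\<close> absorbs
  multiplication by all of \<open>A\<close> and not just by \<open>D (tgt g)\<close>.\<close>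

lemma D_mult_left: "\<lbrakk>g \<in> Arr G; a \<in> D g; r \<in> carrier A\<rbrakk> \<Longrightarrow> r \<otimes>\<^bsub>A\<^esub> a \<in> D g"
  by (rule D_I) (simp_all add: mult_closed mult_assoc D_carrier)

lemma D_mult_right: "\<lbrakk>g \<in> Arr G; a \<in> D g; r \<in> carrier A\<rbrakk> \<Longrightarrow> a \<otimes>\<^bsub>A\<^esub> r \<in> D g"
  using idem_comm[of g a r] D_carrier[of g a] by (intro D_I) (auto simp: mult_closed)

lemma idem_mult_in_D:
  "\<lbrakk>g \<in> Arr G; h \<in> Arr G\<rbrakk> \<Longrightarrow> idem g \<otimes>\<^bsub>A\<^esub> idem h \<in> D g"
  "\<lbrakk>g \<in> Arr G; h \<in> Arr G\<rbrakk> \<Longrightarrow> idem g \<otimes>\<^bsub>A\<^esub> idem h \<in> D h"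
  by (simp_all add: D_mult_left D_mult_right idem_in_D)

lemma D_zero [simp]: "g \<in> Arr G \<Longrightarrow> \<zero>\<^bsub>A\<^esub> \<in> D g"
  by (rule D_I) (simp_all add: mult_zero_left)

lemma D_add: "\<lbrakk>g \<in> Arr G; a \<in> D g; b \<in> D g\<rbrakk> \<Longrightarrow> a \<oplus>\<^bsub>A\<^esub> b \<in> D g"
  by (rule D_I) (simp_all add: left_distrib D_carrier)

lemma D_minus: assumes "g \<in> Arr G" "a \<in> D g" shows "\<ominus>\<^bsub>A\<^esub> a \<in> D g"
proof -
  have a: "a \<in> carrier A" using assms D_carrier by blast
  have "(\<ominus>\<^bsub>A\<^esub> a) \<otimes>\<^bsub>A\<^esub> idem g \<oplus>\<^bsub>A\<^esub> a = \<zero>\<^bsub>A\<^esub>"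
    using a assms left_distrib[of "\<ominus>\<^bsub>A\<^esub> a" a "idem g"] by (simp add: l_neg mult_zero_left)
  then have "\<ominus>\<^bsub>A\<^esub> a = (\<ominus>\<^bsub>A\<^esub> a) \<otimes>\<^bsub>A\<^esub> idem g"
    using a assms by (intro minus_equality mult_closed) auto
  then show ?thesis using a assms by (intro D_I) auto
qed

lemma D_finsum:
  assumes "g \<in> Arr G" "\<And>i. i \<in> I \<Longrightarrow> F i \<in> D g"
  shows "finsum A F I \<in> D g"
proof (cases "finite I")
  case True
  then show ?thesis
    using assms(2)
  proof (induction I)
    case (insert i I)
    then show ?case using assms(1) D_carrier by (simp add: D_add Pi_def)
  qed (use assms in simp)
qed (use assms in \<open>simp add: finsum_infinite\<close>)

section \<open>The isomorphisms and their compatibility with the ideals\<close>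

lemma act_closed: "\<lbrakk>g \<in> Arr G; a \<in> D (ginv\<^bsub>G\<^esub> g)\<rbrakk> \<Longrightarrow> \<alpha> g a \<in> D g"
  and act_add: "\<lbrakk>g \<in> Arr G; a \<in> D (ginv\<^bsub>G\<^esub> g); b \<in> D (ginv\<^bsub>G\<^esub> g)\<rbrakk>
    \<Longrightarrow> \<alpha> g (a \<oplus>\<^bsub>A\<^esub> b) = \<alpha> g a \<oplus>\<^bsub>A\<^esub> \<alpha> g b"
  and act_mult: "\<lbrakk>g \<in> Arr G; a \<in> D (ginv\<^bsub>G\<^esub> g); b \<in> D (ginv\<^bsub>G\<^esub> g)\<rbrakk>
    \<Longrightarrow> \<alpha> g (a \<otimes>\<^bsub>A\<^esub> b) = \<alpha> g a \<otimes>\<^bsub>A\<^esub> \<alpha> g b"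
  using ring_isomorphism.hom_add[OF iso, of g a b] ring_isomorphism.hom_mult[OF iso, of g a b]
    bij_betw_imp_surj_on[OF ring_isomorphism.bij[OF iso, of g]] by auto

text \<open>The composite is extended by the action of the object \<open>tgt g\<close>, which fixes
  its ideal pointwise.\<close>

lemma act_inverse:
  assumes "g \<in> Arr G" "a \<in> D g"
  shows "\<alpha> g (\<alpha> (ginv\<^bsub>G\<^esub> g) a) = a"
  using act_extends[of g "ginv\<^bsub>G\<^esub> g" a] act_closed[of "ginv\<^bsub>G\<^esub> g" a] assms act_obj[of "tgt\<^bsub>G\<^esub> g" a]
    D_subset_tgt by auto

lemma act_inverse':
  assumes "g \<in> Arr G" "a \<in> D (ginv\<^bsub>G\<^esub> g)"
  shows "\<alpha> (ginv\<^bsub>G\<^esub> g) (\<alpha> g a) = a"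
  using act_inverse[of "ginv\<^bsub>G\<^esub> g" a] assms by simp

text \<open>Write \<open>a\<close> as \<open>\<alpha> h b\<close> with \<open>b\<close> in the
  domain of \<open>\<alpha> h\<close>. The extension law puts \<open>b\<close> in the domain of the
  action of \<open>g \<cdot> h\<close> and makes \<open>\<alpha> g a\<close> its image under that
  action.\<close>

lemma act_restricts:
  assumes "g \<in> Arr G" "h \<in> Arr G" "src\<^bsub>G\<^esub> g = tgt\<^bsub>G\<^esub> h" "a \<in> D (ginv\<^bsub>G\<^esub> g)" "a \<in> D h"
  shows "\<alpha> g a \<in> D (g \<cdot>\<^bsub>G\<^esub> h)"
proof -
  have b: "\<alpha> (ginv\<^bsub>G\<^esub> h) a \<in> D (ginv\<^bsub>G\<^esub> h)" "\<alpha> h (\<alpha> (ginv\<^bsub>G\<^esub> h) a) = a"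
    using assms act_closed[of "ginv\<^bsub>G\<^esub> h"] act_inverse by auto
  then have "\<alpha> (ginv\<^bsub>G\<^esub> h) a \<in> D (ginv\<^bsub>G\<^esub> (g \<cdot>\<^bsub>G\<^esub> h))"
      and "\<alpha> (g \<cdot>\<^bsub>G\<^esub> h) (\<alpha> (ginv\<^bsub>G\<^esub> h) a) = \<alpha> g a"
    using act_extends[of g h "\<alpha> (ginv\<^bsub>G\<^esub> h) a"] assms by auto
  then show ?thesis using act_closed[of "g \<cdot>\<^bsub>G\<^esub> h"] assms by (metis cmp_closed)
qed

text \<open>The isomorphism matches the intersection of \<open>D (ginv g)\<close> and
  \<open>D h\<close> with that of \<open>D g\<close> and \<open>D (g \<cdot> h)\<close>, so it must
  match their identities \<open>?e\<close> and \<open>?u\<close>. Concretely, the preimage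
  \<open>?b\<close> of \<open>?u\<close> is fixed by \<open>?e\<close>, so \<open>?u\<close> is
  fixed by the image of \<open>?e\<close>; that image in turn is fixed by \<open>?u\<close>.\<close>

lemma act_idem:
  assumes "g \<in> Arr G" "h \<in> Arr G" "src\<^bsub>G\<^esub> g = tgt\<^bsub>G\<^esub> h"
  shows "\<alpha> g (idem h \<otimes>\<^bsub>A\<^esub> idem (ginv\<^bsub>G\<^esub> g)) = idem g \<otimes>\<^bsub>A\<^esub> idem (g \<cdot>\<^bsub>G\<^esub> h)"
proof -
  let ?e = "idem h \<otimes>\<^bsub>A\<^esub> idem (ginv\<^bsub>G\<^esub> g)" and ?u = "idem g \<otimes>\<^bsub>A\<^esub> idem (g \<cdot>\<^bsub>G\<^esub> h)"
  let ?b = "\<alpha> (ginv\<^bsub>G\<^esub> g) ?u"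
  have u: "?u \<in> D g" "?u \<in> D (g \<cdot>\<^bsub>G\<^esub> h)"
    using assms by (simp_all add: idem_mult_in_D)
  have e: "?e \<in> D (ginv\<^bsub>G\<^esub> g)" "?e \<in> D h"
    using assms by (simp_all add: idem_mult_in_D)
  have b: "?b \<in> D (ginv\<^bsub>G\<^esub> g)" "?b \<in> D h" "\<alpha> g ?b = ?u"
    using u act_closed[of "ginv\<^bsub>G\<^esub> g" ?u] act_restricts[of "ginv\<^bsub>G\<^esub> g" "g \<cdot>\<^bsub>G\<^esub> h" ?u] assms act_inverse
    by auto
  have ae: "\<alpha> g ?e \<in> D g" "\<alpha> g ?e \<in> D (g \<cdot>\<^bsub>G\<^esub> h)"
    using e assms act_closed act_restricts by auto
  have "?b \<otimes>\<^bsub>A\<^esub> ?e = ?b"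
    using b assms D_carrier by (simp flip: mult_assoc)
  then have "?u \<otimes>\<^bsub>A\<^esub> \<alpha> g ?e = ?u"
    using act_mult[of g ?b ?e] b e assms by simp
  moreover have "?u \<otimes>\<^bsub>A\<^esub> \<alpha> g ?e = \<alpha> g ?e"
    using ae assms D_carrier by (simp add: mult_assoc idem_left)
  ultimately show ?thesis by simp
qed

text \<open>Extending the isomorphism \<open>\<alpha> g\<close> by zero on the complement of its domain.\<close>

definition ext_act :: "'a \<Rightarrow> 'b \<Rightarrow> 'b" where
  "ext_act g a = \<alpha> g (a \<otimes>\<^bsub>A\<^esub> idem (ginv\<^bsub>G\<^esub> g))"

lemma cut_in_D: "\<lbrakk>g \<in> Arr G; a \<in> carrier A\<rbrakk> \<Longrightarrow> a \<otimes>\<^bsub>A\<^esub> idem g \<in> D g"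
  by (simp add: D_mult_left idem_in_D)

lemma ext_act_eq: "\<lbrakk>g \<in> Arr G; a \<in> D (ginv\<^bsub>G\<^esub> g)\<rbrakk> \<Longrightarrow> ext_act g a = \<alpha> g a"
  by (simp add: ext_act_def)

lemma ext_act_in_D: "\<lbrakk>g \<in> Arr G; a \<in> carrier A\<rbrakk> \<Longrightarrow> ext_act g a \<in> D g"
  by (simp add: ext_act_def act_closed cut_in_D)

lemma ext_act_closed [simp]: "\<lbrakk>g \<in> Arr G; a \<in> carrier A\<rbrakk> \<Longrightarrow> ext_act g a \<in> carrier A"
  using ext_act_in_D D_carrier by blast

lemma ext_act_add:
  "\<lbrakk>g \<in> Arr G; a \<in> carrier A; b \<in> carrier A\<rbrakk> \<Longrightarrow> ext_act g (a \<oplus>\<^bsub>A\<^esub> b) = ext_act g a \<oplus>\<^bsub>A\<^esub> ext_act g b"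
  by (simp add: ext_act_def left_distrib act_add cut_in_D)

text \<open>Cutting down by a central idempotent is multiplicative, and \<open>\<alpha> g\<close> is
  multiplicative on what remains.\<close>

lemma ext_act_mult:
  assumes "g \<in> Arr G" "a \<in> carrier A" "b \<in> carrier A"
  shows "ext_act g (a \<otimes>\<^bsub>A\<^esub> b) = ext_act g a \<otimes>\<^bsub>A\<^esub> ext_act g b"
proof -
  let ?e = "idem (ginv\<^bsub>G\<^esub> g)"
  have "(a \<otimes>\<^bsub>A\<^esub> ?e) \<otimes>\<^bsub>A\<^esub> (b \<otimes>\<^bsub>A\<^esub> ?e) = (a \<otimes>\<^bsub>A\<^esub> (b \<otimes>\<^bsub>A\<^esub> ?e)) \<otimes>\<^bsub>A\<^esub> ?e"
    using assms by (simp add: idem_comm mult_closed)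
  also have "\<dots> = (a \<otimes>\<^bsub>A\<^esub> b) \<otimes>\<^bsub>A\<^esub> ?e"
    using assms by (simp add: mult_assoc mult_closed idem_in_D)
  finally show ?thesis
    using assms by (simp add: ext_act_def cut_in_D flip: act_mult)
qed

lemma ext_act_zero [simp]: assumes "g \<in> Arr G" shows "ext_act g \<zero>\<^bsub>A\<^esub> = \<zero>\<^bsub>A\<^esub>"
  using ext_act_add[of g "\<zero>\<^bsub>A\<^esub>" "\<zero>\<^bsub>A\<^esub>"] assms
  by (simp add: add.l_cancel_one)

lemma ext_act_idem:
  "\<lbrakk>g \<in> Arr G; h \<in> Arr G; src\<^bsub>G\<^esub> g = tgt\<^bsub>G\<^esub> h\<rbrakk>
    \<Longrightarrow> ext_act g (idem h) = idem g \<otimes>\<^bsub>A\<^esub> idem (g \<cdot>\<^bsub>G\<^esub> h)"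
  by (simp add: ext_act_def act_idem)

text \<open>The argument is cut down to a part on which both \<open>\<alpha> h\<close> and the
  action of \<open>g \<cdot> h\<close> are defined and the extension law applies. The two cuts are
  then pushed through the maps by \<open>ext_act_idem\<close>.\<close>

lemma ext_act_ext_act:
  assumes "g \<in> Arr G" "h \<in> Arr G" "src\<^bsub>G\<^esub> g = tgt\<^bsub>G\<^esub> h" "c \<in> carrier A"
  shows "ext_act g (ext_act h c) = idem g \<otimes>\<^bsub>A\<^esub> ext_act (g \<cdot>\<^bsub>G\<^esub> h) c"
proof -
  let ?k = "g \<cdot>\<^bsub>G\<^esub> h" and ?h' = "ginv\<^bsub>G\<^esub> h"
  let ?e = "idem ?h'" and ?e' = "idem (ginv\<^bsub>G\<^esub> ?k)" and ?d = "idem (ginv\<^bsub>G\<^esub> g)"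
  have k': "ginv\<^bsub>G\<^esub> ?k = ?h' \<cdot>\<^bsub>G\<^esub> ginv\<^bsub>G\<^esub> g"
    using assms by (simp add: ginv_of_cmp)
  \<comment> \<open>The part of \<open>c\<close> lying in the domains of both
    \<open>\<alpha> h\<close> and \<open>\<alpha> ?k\<close>.\<close>
  let ?a = "(c \<otimes>\<^bsub>A\<^esub> ?e') \<otimes>\<^bsub>A\<^esub> ?e"
  have a: "?a \<in> D ?h'" "?a \<in> D (ginv\<^bsub>G\<^esub> ?k)"
    using assms by (auto intro!: cut_in_D mult_closed D_mult_right)
  \<comment> \<open>Here \<open>h\<close> times the inverse of \<open>?k\<close> is
    \<open>ginv g\<close>, so the cut by \<open>?e'\<close> turns into the cut by \<open>?d\<close>,
    which is the one that \<open>ext_act g\<close> performs anyway.\<close>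
  have "ext_act h (?e') = idem h \<otimes>\<^bsub>A\<^esub> ?d"
    using ext_act_idem[of h "ginv\<^bsub>G\<^esub> ?k"] assms by (simp add: k')
  then have "ext_act h (c \<otimes>\<^bsub>A\<^esub> ?e') = ext_act h c \<otimes>\<^bsub>A\<^esub> ?d"
    using assms ext_act_in_D[of h c] by (simp add: ext_act_mult flip: mult_assoc)
  then have ha: "\<alpha> h ?a = ext_act h c \<otimes>\<^bsub>A\<^esub> ?d"
    by (simp add: ext_act_def)
  have "ext_act g (ext_act h c) = \<alpha> g (\<alpha> h ?a)"
    by (simp add: ha ext_act_def[of g])
  also have "\<dots> = \<alpha> ?k ?a"
    using act_extends[of g h ?a] a assms by (simp add: ha cut_in_D)
  also have "\<dots> = ext_act ?k (c \<otimes>\<^bsub>A\<^esub> ?e)"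
    using assms idem_comm[of "ginv\<^bsub>G\<^esub> ?k" c ?e] by (simp add: ext_act_def)
  \<comment> \<open>Since \<open>?k\<close> times \<open>ginv h\<close> is \<open>g\<close>, the cut
    by \<open>?e\<close> becomes the factor \<open>idem g\<close>.\<close>
  also have "\<dots> = ext_act ?k c \<otimes>\<^bsub>A\<^esub> (idem ?k \<otimes>\<^bsub>A\<^esub> idem g)"
    using assms ext_act_idem[of ?k ?h'] by (simp add: ext_act_mult cmp_assoc)
  also have "\<dots> = idem g \<otimes>\<^bsub>A\<^esub> ext_act ?k c"
    using assms ext_act_in_D[of ?k c] idem_identity(2)[of g "ext_act ?k c"] by (simp flip: mult_assoc)
  finally show ?thesis .
qed

text \<open>A left factor from \<open>D g\<close> swallows \<open>idem g\<close>, so behind such a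
  factor the extended maps compose strictly.\<close>

lemma mult_ext_act_ext_act:
  assumes "g \<in> Arr G" "h \<in> Arr G" "src\<^bsub>G\<^esub> g = tgt\<^bsub>G\<^esub> h" "c \<in> carrier A" "a \<in> D g"
  shows "a \<otimes>\<^bsub>A\<^esub> ext_act g (ext_act h c) = a \<otimes>\<^bsub>A\<^esub> ext_act (g \<cdot>\<^bsub>G\<^esub> h) c"
  using assms D_carrier[of g a] mult_assoc[of a "idem g" "ext_act (g \<cdot>\<^bsub>G\<^esub> h) c"]
  by (simp add: ext_act_ext_act)

section \<open>The partial skew groupoid ring\<close>

abbreviation skew :: "('a \<Rightarrow> 'b) ring" where
  "skew \<equiv> skew_ring G A D \<alpha>"

lemma skew_memD:
  assumes "f \<in> carrier skew"
  shows "g \<in> Arr G \<Longrightarrow> f g \<in> D g" "g \<notin> Arr G \<Longrightarrow> f g = \<zero>\<^bsub>A\<^esub>" "f g \<in> carrier A"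
    "finite {g \<in> Arr G. f g \<noteq> \<zero>\<^bsub>A\<^esub>}"
proof -
  show *: "g \<in> Arr G \<Longrightarrow> f g \<in> D g" "g \<notin> Arr G \<Longrightarrow> f g = \<zero>\<^bsub>A\<^esub>"
    and "finite {g \<in> Arr G. f g \<noteq> \<zero>\<^bsub>A\<^esub>}"
    using assms by (auto simp: skew_ring_def)
  show "f g \<in> carrier A"
    using * D_carrier by (cases "g \<in> Arr G") auto
qed

text \<open>The working form of the product. \<open>S\<close> may be any finite set of arrows
  containing the support of \<open>f\<close>, so that several products can be summed over a common
  index set.\<close>

lemma skew_mult:
  assumes "f \<in> carrier skew" "f' \<in> carrier skew" "k \<in> Arr G" "finite S" "S \<subseteq> Arr G"
    and "\<And>g. \<lbrakk>g \<in> Arr G; g \<notin> S\<rbrakk> \<Longrightarrow> f g = \<zero>\<^bsub>A\<^esub>"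
  shows "(f \<otimes>\<^bsub>skew\<^esub> f') k
    = finsum A (\<lambda>g. f g \<otimes>\<^bsub>A\<^esub> ext_act g (f' (ginv\<^bsub>G\<^esub> g \<cdot>\<^bsub>G\<^esub> k))) {g \<in> S. tgt\<^bsub>G\<^esub> g = tgt\<^bsub>G\<^esub> k}"
proof -
  have "(f \<otimes>\<^bsub>skew\<^esub> f') k = finsum A (\<lambda>(g, h). f g \<otimes>\<^bsub>A\<^esub> ext_act g (f' h))
      {(g, h). g \<in> Arr G \<and> h \<in> Arr G \<and> src\<^bsub>G\<^esub> g = tgt\<^bsub>G\<^esub> h \<and> g \<cdot>\<^bsub>G\<^esub> h = k \<and>
         f g \<noteq> \<zero>\<^bsub>A\<^esub> \<and> f' h \<noteq> \<zero>\<^bsub>A\<^esub>}"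
    by (simp add: skew_ring_def ext_act_def)
  also have "\<dots> = finsum A (\<lambda>g. f g \<otimes>\<^bsub>A\<^esub> ext_act g (f' (ginv\<^bsub>G\<^esub> g \<cdot>\<^bsub>G\<^esub> k)))
      {g \<in> S. tgt\<^bsub>G\<^esub> g = tgt\<^bsub>G\<^esub> k}"
    using assms by (intro finsum_factorizations)
      (auto simp: abelian_monoid_axioms skew_memD mult_closed mult_zero_left mult_zero_right)
  finally show ?thesis .
qed

lemma skew_mult_outside: "k \<notin> Arr G \<Longrightarrow> (f \<otimes>\<^bsub>skew\<^esub> f') k = \<zero>\<^bsub>A\<^esub>"
  by (auto simp: skew_ring_def intro!: add.finprod_one_eqI)

text \<open>Otherwise the sum defining the coefficient is empty.\<close>

lemma skew_mult_nonzeroE: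
  assumes "(f \<otimes>\<^bsub>skew\<^esub> f') k \<noteq> \<zero>\<^bsub>A\<^esub>"
  obtains g h where "g \<in> Arr G" "h \<in> Arr G" "src\<^bsub>G\<^esub> g = tgt\<^bsub>G\<^esub> h" "k = g \<cdot>\<^bsub>G\<^esub> h"
    "f g \<noteq> \<zero>\<^bsub>A\<^esub>" "f' h \<noteq> \<zero>\<^bsub>A\<^esub>"
proof (rule ccontr)
  assume "\<not> thesis"
  then have empty: "{(g, h). g \<in> Arr G \<and> h \<in> Arr G \<and> src\<^bsub>G\<^esub> g = tgt\<^bsub>G\<^esub> h \<and> g \<cdot>\<^bsub>G\<^esub> h = k \<and>
      f g \<noteq> \<zero>\<^bsub>A\<^esub> \<and> f' h \<noteq> \<zero>\<^bsub>A\<^esub>} = {}"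
    using that by blast
  have "(f \<otimes>\<^bsub>skew\<^esub> f') k = \<zero>\<^bsub>A\<^esub>"
    by (simp only: skew_ring_def ring_record_simps monoid.simps empty finsum_empty)
  with assms show False by simp
qed

end

text \<open>Stated for arbitrary families of additive subgroups, so that it covers both
  \<open>skew\<close> and \<open>star\<close>. Addition is pointwise, and the support of a sum lies
  in the union of the supports.\<close>

lemma skew_ring_abelian_group:
  assumes "abelian_group A" "\<And>g. g \<in> Arr H \<Longrightarrow> additive_subgroup (D g) A"
  shows "abelian_group (skew_ring H A D \<alpha>)"
proof -
  interpret A: abelian_group A by fact
  let ?C = "carrier (skew_ring H A D \<alpha>)"
  have sub: "\<zero>\<^bsub>A\<^esub> \<in> D g" "a \<in> D g \<Longrightarrow> a \<in> carrier A" "a \<in> D g \<Longrightarrow> \<ominus>\<^bsub>A\<^esub> a \<in> D g"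
    "\<lbrakk>a \<in> D g; b \<in> D g\<rbrakk> \<Longrightarrow> a \<oplus>\<^bsub>A\<^esub> b \<in> D g" if "g \<in> Arr H" for g a b
    using assms(2)[OF that] additive_subgroup.a_subset[of "D g" A]
      additive_subgroup.zero_closed additive_subgroup.a_inv_closed
      additive_subgroup.a_closed by fast+
  have value_closed: "f g \<in> carrier A" if "f \<in> ?C" for f g
    using that sub(2) by (cases "g \<in> Arr H") (auto simp: skew_ring_def)
  have add_closed: "(\<lambda>g. f g \<oplus>\<^bsub>A\<^esub> f' g) \<in> ?C" if "f \<in> ?C" "f' \<in> ?C" for f f'
  proof -
    have "{g \<in> Arr H. f g \<oplus>\<^bsub>A\<^esub> f' g \<noteq> \<zero>\<^bsub>A\<^esub>}
        \<subseteq> {g \<in> Arr H. f g \<noteq> \<zero>\<^bsub>A\<^esub>} \<union> {g \<in> Arr H. f' g \<noteq> \<zero>\<^bsub>A\<^esub>}"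
      by auto
    then have "finite {g \<in> Arr H. f g \<oplus>\<^bsub>A\<^esub> f' g \<noteq> \<zero>\<^bsub>A\<^esub>}"
      using that by (auto simp: skew_ring_def intro: finite_subset)
    with that sub(4) show ?thesis by (auto simp: skew_ring_def)
  qed
  have minus_closed: "(\<lambda>g. \<ominus>\<^bsub>A\<^esub> f g) \<in> ?C" if "f \<in> ?C" for f
  proof -
    have "{g \<in> Arr H. \<ominus>\<^bsub>A\<^esub> f g \<noteq> \<zero>\<^bsub>A\<^esub>} \<subseteq> {g \<in> Arr H. f g \<noteq> \<zero>\<^bsub>A\<^esub>}"
      by auto
    then have "finite {g \<in> Arr H. \<ominus>\<^bsub>A\<^esub> f g \<noteq> \<zero>\<^bsub>A\<^esub>}"
      using that by (auto simp: skew_ring_def intro: finite_subset)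
    with that sub(3) show ?thesis by (auto simp: skew_ring_def)
  qed
  show ?thesis
  proof (rule abelian_groupI, goal_cases)
    case (1 f f') then show ?case using add_closed by (simp add: skew_ring_def)
  next
    case 2 then show ?case using sub(1) by (auto simp: skew_ring_def)
  next
    case (3 f f' f'')
    then show ?case
      using value_closed by (simp add: skew_ring_def A.a_assoc)
  next
    case (4 f f')
    then show ?case
      using value_closed by (simp add: skew_ring_def A.a_comm)
  next
    case (5 f) then show ?case using value_closed by (simp add: skew_ring_def)
  next
    case (6 f)
    then show ?case
      using minus_closed value_closed
      by (intro bexI[of _ "\<lambda>g. \<ominus>\<^bsub>A\<^esub> f g"]) (simp_all add: skew_ring_def A.l_neg)
  qed
qed

section \<open>The ring axioms of the partial skew groupoid ring\<close>

context unital_partial_action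
begin

lemma D_additive: assumes "g \<in> Arr G" shows "additive_subgroup (D g) A"
proof (intro additive_subgroupI add.subgroupI)
  show "D g \<noteq> {}" using D_zero[OF assms] by blast
qed (use assms D_carrier D_add D_minus in \<open>auto simp: a_inv_def\<close>)

lemma skew_abelian_group: "abelian_group skew"
  by (simp add: skew_ring_abelian_group abelian_group_axioms D_additive)

lemma skew_eqI:
  assumes "f \<in> carrier skew" "f' \<in> carrier skew" "\<And>k. k \<in> Arr G \<Longrightarrow> f k = f' k"
  shows "f = f'"
proof
  fix k show "f k = f' k"
    using assms by (cases "k \<in> Arr G") (simp_all add: skew_memD)
qed

lemma ext_act_restricts:
  assumes "g \<in> Arr G" "h \<in> Arr G" "src\<^bsub>G\<^esub> g = tgt\<^bsub>G\<^esub> h" "b \<in> D h"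
  shows "ext_act g b \<in> D (g \<cdot>\<^bsub>G\<^esub> h)"
  using assms D_carrier[of h b] unfolding ext_act_def
  by (intro act_restricts cut_in_D D_mult_right) simp_all

lemma ext_act_finsum:
  assumes "g \<in> Arr G" "finite I" "\<And>i. i \<in> I \<Longrightarrow> F i \<in> carrier A"
  shows "ext_act g (finsum A F I) = finsum A (\<lambda>i. ext_act g (F i)) I"
  using assms
  by (intro additive_finsum) (auto simp: abelian_monoid_axioms ext_act_add)

lemma skew_mult_support:
  assumes "f \<in> carrier skew" "f' \<in> carrier skew"
  shows "finite {k \<in> Arr G. (f \<otimes>\<^bsub>skew\<^esub> f') k \<noteq> \<zero>\<^bsub>A\<^esub>}"
proof (rule finite_subset)
  let ?S = "{g \<in> Arr G. f g \<noteq> \<zero>\<^bsub>A\<^esub>}" and ?T = "{g \<in> Arr G. f' g \<noteq> \<zero>\<^bsub>A\<^esub>}"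
  show "{k \<in> Arr G. (f \<otimes>\<^bsub>skew\<^esub> f') k \<noteq> \<zero>\<^bsub>A\<^esub>} \<subseteq> (\<lambda>(g, h). g \<cdot>\<^bsub>G\<^esub> h) ` (?S \<times> ?T)"
    by (auto elim!: skew_mult_nonzeroE)
  show "finite ((\<lambda>(g, h). g \<cdot>\<^bsub>G\<^esub> h) ` (?S \<times> ?T))"
    using assms skew_memD(4) by blast
qed

lemma skew_carrierI:
  assumes "\<And>g. g \<in> Arr G \<Longrightarrow> f g \<in> D g" "\<And>g. g \<notin> Arr G \<Longrightarrow> f g = \<zero>\<^bsub>A\<^esub>"
    "finite {g \<in> Arr G. f g \<noteq> \<zero>\<^bsub>A\<^esub>}"
  shows "f \<in> carrier skew"
  using assms by (simp add: skew_ring_def)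

text \<open>Every term of the coefficient at \<open>k\<close> lies in the ideal \<open>D k\<close>,
  because \<open>ext_act g\<close> carries the ideal of \<open>ginv g \<cdot> k\<close> into that of
  \<open>k\<close>.\<close>

lemma skew_mult_closed:
  assumes "f \<in> carrier skew" "f' \<in> carrier skew"
  shows "f \<otimes>\<^bsub>skew\<^esub> f' \<in> carrier skew"
proof -
  have "(f \<otimes>\<^bsub>skew\<^esub> f') k \<in> D k" if k: "k \<in> Arr G" for k
  proof -
    have "ext_act g (f' (ginv\<^bsub>G\<^esub> g \<cdot>\<^bsub>G\<^esub> k)) \<in> D k" if "g \<in> Arr G" "tgt\<^bsub>G\<^esub> g = tgt\<^bsub>G\<^esub> k" for g
      using ext_act_restricts[of g "ginv\<^bsub>G\<^esub> g \<cdot>\<^bsub>G\<^esub> k"] that k assms(2) by (simp add: skew_memD)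
    then show ?thesis
      using assms k
      by (subst skew_mult[where S = "{g \<in> Arr G. f g \<noteq> \<zero>\<^bsub>A\<^esub>}"])
         (auto simp: skew_memD intro!: D_finsum D_mult_left)
  qed
  moreover have "\<And>k. k \<notin> Arr G \<Longrightarrow> (f \<otimes>\<^bsub>skew\<^esub> f') k = \<zero>\<^bsub>A\<^esub>"
    by (rule skew_mult_outside)
  moreover note skew_mult_support[OF assms]
  ultimately show ?thesis
    by (intro skew_carrierI)
qed

lemma skew_add [simp]: "(f \<oplus>\<^bsub>skew\<^esub> f') g = f g \<oplus>\<^bsub>A\<^esub> f' g"
  by (simp add: skew_ring_def)

text \<open>Both sides expand to one double sum over the first factor \<open>g\<close> and the
  product \<open>m\<close> of the first two factors. Indexing by \<open>m\<close> instead of the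
  second factor \<open>h\<close> makes the two ranges independent, so the sums can be
  exchanged.\<close>

lemma skew_mult_assoc:
  assumes f: "f \<in> carrier skew" and f': "f' \<in> carrier skew" and f'': "f'' \<in> carrier skew"
  shows "(f \<otimes>\<^bsub>skew\<^esub> f') \<otimes>\<^bsub>skew\<^esub> f'' = f \<otimes>\<^bsub>skew\<^esub> (f' \<otimes>\<^bsub>skew\<^esub> f'')"
proof (rule skew_eqI)
  fix k assume k: "k \<in> Arr G"
  define S where "S = {g \<in> Arr G. f g \<noteq> \<zero>\<^bsub>A\<^esub>}"
  define T where "T = {g \<in> Arr G. f' g \<noteq> \<zero>\<^bsub>A\<^esub>}"
  \<comment> \<open>\<open>M\<close> collects the composites of support elements, so it contains the
    support of the product of \<open>f\<close> and \<open>f'\<close>.\<close>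
  define M where "M = (\<lambda>(g, h). g \<cdot>\<^bsub>G\<^esub> h) ` {(g, h) \<in> S \<times> T. src\<^bsub>G\<^esub> g = tgt\<^bsub>G\<^esub> h}"
  have "finite S" "finite T"
    using f f' skew_memD(4) by (auto simp: S_def T_def)
  moreover from this have "finite {(g, h) \<in> S \<times> T. src\<^bsub>G\<^esub> g = tgt\<^bsub>G\<^esub> h}"
    by - (rule finite_subset[of _ "S \<times> T"], auto)
  ultimately have fin: "finite S" "finite T" "finite M"
    by (auto simp: M_def)
  have sub: "S \<subseteq> Arr G" "T \<subseteq> Arr G" "M \<subseteq> Arr G"
    by (auto simp: S_def T_def M_def)
  let ?S = "{g \<in> S. tgt\<^bsub>G\<^esub> g = tgt\<^bsub>G\<^esub> k}" and ?M = "{m \<in> M. tgt\<^bsub>G\<^esub> m = tgt\<^bsub>G\<^esub> k}"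
  have zeroM: "(f \<otimes>\<^bsub>skew\<^esub> f') m = \<zero>\<^bsub>A\<^esub>" if "m \<in> Arr G" "m \<notin> M" for m
  proof (rule ccontr)
    assume "(f \<otimes>\<^bsub>skew\<^esub> f') m \<noteq> \<zero>\<^bsub>A\<^esub>"
    then obtain g h where gh: "g \<in> Arr G" "h \<in> Arr G" "src\<^bsub>G\<^esub> g = tgt\<^bsub>G\<^esub> h" "m = g \<cdot>\<^bsub>G\<^esub> h"
        "f g \<noteq> \<zero>\<^bsub>A\<^esub>" "f' h \<noteq> \<zero>\<^bsub>A\<^esub>"
      by (rule skew_mult_nonzeroE)
    then have "(g, h) \<in> {(g, h) \<in> S \<times> T. src\<^bsub>G\<^esub> g = tgt\<^bsub>G\<^esub> h}"
      by (simp add: S_def T_def)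
    then have "m \<in> M"
      unfolding M_def gh(4) by (rule rev_image_eqI) simp
    with that(2) show False by simp
  qed
  \<comment> \<open>The common summand; it involves \<open>ginv g \<cdot> m\<close> in place of the
    middle factor \<open>h\<close>.\<close>
  let ?F = "\<lambda>g m. f g \<otimes>\<^bsub>A\<^esub> (ext_act g (f' (ginv\<^bsub>G\<^esub> g \<cdot>\<^bsub>G\<^esub> m)) \<otimes>\<^bsub>A\<^esub> ext_act m (f'' (ginv\<^bsub>G\<^esub> m \<cdot>\<^bsub>G\<^esub> k)))"
  have closed: "?F g m \<in> carrier A" if "g \<in> Arr G" "m \<in> Arr G" for g m
    using that f f' f'' by (simp add: mult_closed skew_memD)
  have "((f \<otimes>\<^bsub>skew\<^esub> f') \<otimes>\<^bsub>skew\<^esub> f'') k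
      = finsum A (\<lambda>m. (f \<otimes>\<^bsub>skew\<^esub> f') m \<otimes>\<^bsub>A\<^esub> ext_act m (f'' (ginv\<^bsub>G\<^esub> m \<cdot>\<^bsub>G\<^esub> k))) ?M"
    using fin sub by (intro skew_mult skew_mult_closed f f' f'' k zeroM) auto
  also have "\<dots> = finsum A (\<lambda>m. finsum A (\<lambda>g. ?F g m) ?S) ?M"
  proof (intro finsum_cong' refl)
    fix m assume m: "m \<in> ?M"
    then have mG: "m \<in> Arr G" using sub by auto
    have "(f \<otimes>\<^bsub>skew\<^esub> f') m \<otimes>\<^bsub>A\<^esub> ext_act m (f'' (ginv\<^bsub>G\<^esub> m \<cdot>\<^bsub>G\<^esub> k))
        = finsum A (\<lambda>g. f g \<otimes>\<^bsub>A\<^esub> ext_act g (f' (ginv\<^bsub>G\<^esub> g \<cdot>\<^bsub>G\<^esub> m))) ?S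
          \<otimes>\<^bsub>A\<^esub> ext_act m (f'' (ginv\<^bsub>G\<^esub> m \<cdot>\<^bsub>G\<^esub> k))"
      using skew_mult[OF f f' mG fin(1) sub(1)] m by (simp add: S_def)
    also have "\<dots> = finsum A (\<lambda>g. (f g \<otimes>\<^bsub>A\<^esub> ext_act g (f' (ginv\<^bsub>G\<^esub> g \<cdot>\<^bsub>G\<^esub> m)))
          \<otimes>\<^bsub>A\<^esub> ext_act m (f'' (ginv\<^bsub>G\<^esub> m \<cdot>\<^bsub>G\<^esub> k))) ?S"
      using fin sub mG f f' f'' by (intro mult_finsum_left) (auto simp: mult_closed skew_memD)
    also have "\<dots> = finsum A (\<lambda>g. ?F g m) ?S"
      using sub mG f f' f'' closed
      by (intro finsum_cong') (auto simp: mult_assoc skew_memD subset_iff)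
    finally show "(f \<otimes>\<^bsub>skew\<^esub> f') m \<otimes>\<^bsub>A\<^esub> ext_act m (f'' (ginv\<^bsub>G\<^esub> m \<cdot>\<^bsub>G\<^esub> k)) = finsum A (\<lambda>g. ?F g m) ?S" .
  qed (use sub in \<open>auto intro!: finsum_closed closed\<close>)
  also have "\<dots> = finsum A (\<lambda>g. finsum A (?F g) ?M) ?S"
    using fin sub by (intro finsum_swap closed) auto
  also have "\<dots> = finsum A (\<lambda>g. f g \<otimes>\<^bsub>A\<^esub> ext_act g ((f' \<otimes>\<^bsub>skew\<^esub> f'') (ginv\<^bsub>G\<^esub> g \<cdot>\<^bsub>G\<^esub> k))) ?S"
  proof (intro finsum_cong' refl)
    fix g assume g: "g \<in> ?S"
    then have gG: "g \<in> Arr G" and gk: "tgt\<^bsub>G\<^esub> g = tgt\<^bsub>G\<^esub> k" using sub by auto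
    let ?k = "ginv\<^bsub>G\<^esub> g \<cdot>\<^bsub>G\<^esub> k" and ?T = "{h \<in> T. tgt\<^bsub>G\<^esub> h = src\<^bsub>G\<^esub> g}"
    let ?H = "\<lambda>h. f' h \<otimes>\<^bsub>A\<^esub> ext_act h (f'' (ginv\<^bsub>G\<^esub> h \<cdot>\<^bsub>G\<^esub> ?k))"
    have "(f' \<otimes>\<^bsub>skew\<^esub> f'') ?k = finsum A ?H ?T"
      using skew_mult[OF f' f'' _ fin(2) sub(2), of ?k] gG gk k by (simp add: T_def)
    then have "f g \<otimes>\<^bsub>A\<^esub> ext_act g ((f' \<otimes>\<^bsub>skew\<^esub> f'') ?k) = f g \<otimes>\<^bsub>A\<^esub> ext_act g (finsum A ?H ?T)"
      by simp
    also have "\<dots> = f g \<otimes>\<^bsub>A\<^esub> finsum A (\<lambda>h. ext_act g (?H h)) ?T"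
      using fin sub gG f' f'' by (subst ext_act_finsum) (auto simp: skew_memD mult_closed subset_iff)
    also have "\<dots> = finsum A (\<lambda>h. f g \<otimes>\<^bsub>A\<^esub> ext_act g (?H h)) ?T"
      using fin sub gG f f' f'' by (intro mult_finsum_right) (auto simp: skew_memD mult_closed subset_iff)
    also have "\<dots> = finsum A (\<lambda>h. ?F g (g \<cdot>\<^bsub>G\<^esub> h)) ?T"
    proof (intro finsum_cong' refl)
      fix h assume h: "h \<in> ?T"
      then have hG: "h \<in> Arr G" "src\<^bsub>G\<^esub> g = tgt\<^bsub>G\<^esub> h" using sub by auto
      let ?c = "f'' (ginv\<^bsub>G\<^esub> h \<cdot>\<^bsub>G\<^esub> ?k)"
      have c: "?c = f'' (ginv\<^bsub>G\<^esub> (g \<cdot>\<^bsub>G\<^esub> h) \<cdot>\<^bsub>G\<^esub> k)"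
        using gG hG gk k by (simp add: ginv_of_cmp cmp_assoc)
      have car: "f g \<in> carrier A" "f' h \<in> carrier A" "?c \<in> carrier A"
        using f f' f'' by (simp_all add: skew_memD)
      have "f g \<otimes>\<^bsub>A\<^esub> ext_act g (?H h)
          = (f g \<otimes>\<^bsub>A\<^esub> ext_act g (f' h)) \<otimes>\<^bsub>A\<^esub> ext_act g (ext_act h ?c)"
        using gG hG car by (simp add: ext_act_mult mult_assoc)
      \<comment> \<open>The left factor lies in \<open>D g\<close>, so the composite of extended
        maps fuses into that of \<open>g \<cdot> h\<close>.\<close>
      also have "\<dots> = (f g \<otimes>\<^bsub>A\<^esub> ext_act g (f' h)) \<otimes>\<^bsub>A\<^esub> ext_act (g \<cdot>\<^bsub>G\<^esub> h) ?c"
        using gG hG car by (intro mult_ext_act_ext_act D_mult_left ext_act_in_D)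
      also have "\<dots> = ?F g (g \<cdot>\<^bsub>G\<^esub> h)"
        using gG hG car by (simp add: mult_assoc c)
      finally show "f g \<otimes>\<^bsub>A\<^esub> ext_act g (?H h) = ?F g (g \<cdot>\<^bsub>G\<^esub> h)" .
    qed (use sub gG in \<open>auto intro!: closed\<close>)
    also have "\<dots> = finsum A (?F g) ((\<lambda>h. g \<cdot>\<^bsub>G\<^esub> h) ` ?T)"
    proof (rule finsum_reindex[symmetric])
      show "?F g \<in> (\<lambda>h. g \<cdot>\<^bsub>G\<^esub> h) ` ?T \<rightarrow> carrier A"
        using gG sub by (auto intro!: closed)
      show "inj_on (\<lambda>h. g \<cdot>\<^bsub>G\<^esub> h) ?T"
        using gG sub ginv_cmp_cancel[OF gG] by (intro inj_onI) (metis (mono_tags, lifting) mem_Collect_eq subsetD)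
    qed
    also have "\<dots> = finsum A (?F g) ?M"
    proof (rule add.finprod_mono_neutral_cong_left)
      show "(\<lambda>h. g \<cdot>\<^bsub>G\<^esub> h) ` ?T \<subseteq> ?M"
      proof (intro subsetI, elim imageE)
        fix m h assume m: "m = g \<cdot>\<^bsub>G\<^esub> h" and h: "h \<in> ?T"
        then have "m \<in> M"
          using g unfolding M_def by (intro image_eqI[of _ _ "(g, h)"]) auto
        then show "m \<in> ?M"
          using m h sub gG gk by auto
      qed
      \<comment> \<open>For such \<open>m\<close> the arrow \<open>ginv g \<cdot> m\<close> lies
        outside the support of \<open>f'\<close>: otherwise \<open>m\<close> would be
        \<open>g\<close> times an element of \<open>?T\<close>.\<close>
      show "?F g m = \<zero>\<^bsub>A\<^esub>" if "m \<in> ?M - (\<lambda>h. g \<cdot>\<^bsub>G\<^esub> h) ` ?T" for m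
      proof -
        have m: "m \<in> Arr G" "tgt\<^bsub>G\<^esub> m = tgt\<^bsub>G\<^esub> k" using that sub by auto
        then have "ginv\<^bsub>G\<^esub> g \<cdot>\<^bsub>G\<^esub> m \<notin> T"
          using that gG gk image_eqI[of m "\<lambda>h. g \<cdot>\<^bsub>G\<^esub> h" "ginv\<^bsub>G\<^esub> g \<cdot>\<^bsub>G\<^esub> m" ?T] by auto
        then have "f' (ginv\<^bsub>G\<^esub> g \<cdot>\<^bsub>G\<^esub> m) = \<zero>\<^bsub>A\<^esub>"
          using m gG gk by (simp add: T_def)
        then show ?thesis
          using m gG f f'' by (simp add: mult_zero_left mult_zero_right skew_memD)
      qed
    qed (use fin sub gG in \<open>auto intro!: closed\<close>)
    finally show "finsum A (?F g) ?M = f g \<otimes>\<^bsub>A\<^esub> ext_act g ((f' \<otimes>\<^bsub>skew\<^esub> f'') ?k)" ..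
  qed (use sub f f' f'' in \<open>auto simp: mult_closed skew_memD skew_mult_closed subset_iff\<close>)
  also have "\<dots> = (f \<otimes>\<^bsub>skew\<^esub> (f' \<otimes>\<^bsub>skew\<^esub> f'')) k"
    using fin sub by (intro skew_mult[symmetric] skew_mult_closed f f' f'' k) (auto simp: S_def)
  finally show "((f \<otimes>\<^bsub>skew\<^esub> f') \<otimes>\<^bsub>skew\<^esub> f'') k = (f \<otimes>\<^bsub>skew\<^esub> (f' \<otimes>\<^bsub>skew\<^esub> f'')) k" .
qed (intro skew_mult_closed f f' f'')+

lemma skew_nonunital_ring: "nonunital_ring skew"
proof -
  interpret S: abelian_group skew by (rule skew_abelian_group)
  show ?thesis
  proof (unfold_locales, goal_cases)
    case (1 a b) then show ?case by (rule skew_mult_closed)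
  next
    case (2 a b c) then show ?case by (rule skew_mult_assoc)
  next
    case (3 a b c)
    \<comment> \<open>The union of both supports lets all three products be summed over the same
      set.\<close>
    let ?S = "{g \<in> Arr G. a g \<noteq> \<zero>\<^bsub>A\<^esub>} \<union> {g \<in> Arr G. b g \<noteq> \<zero>\<^bsub>A\<^esub>}"
    have S: "finite ?S" "?S \<subseteq> Arr G" using 3 skew_memD(4) by auto
    show ?case
    proof (rule skew_eqI)
      fix k assume k: "k \<in> Arr G"
      let ?e = "\<lambda>g. ext_act g (c (ginv\<^bsub>G\<^esub> g \<cdot>\<^bsub>G\<^esub> k))" and ?Sk = "{g \<in> ?S. tgt\<^bsub>G\<^esub> g = tgt\<^bsub>G\<^esub> k}"
      have "((a \<oplus>\<^bsub>skew\<^esub> b) \<otimes>\<^bsub>skew\<^esub> c) k = finsum A (\<lambda>g. (a g \<oplus>\<^bsub>A\<^esub> b g) \<otimes>\<^bsub>A\<^esub> ?e g) ?Sk"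
        using skew_mult[OF _ 3(3) k S, of "a \<oplus>\<^bsub>skew\<^esub> b"] 3 by simp
      also have "\<dots> = finsum A (\<lambda>g. a g \<otimes>\<^bsub>A\<^esub> ?e g \<oplus>\<^bsub>A\<^esub> b g \<otimes>\<^bsub>A\<^esub> ?e g) ?Sk"
        using 3 by (intro finsum_cong') (auto simp: skew_memD left_distrib mult_closed)
      also have "\<dots> = finsum A (\<lambda>g. a g \<otimes>\<^bsub>A\<^esub> ?e g) ?Sk \<oplus>\<^bsub>A\<^esub> finsum A (\<lambda>g. b g \<otimes>\<^bsub>A\<^esub> ?e g) ?Sk"
        using 3 by (intro finsum_addf) (auto simp: skew_memD mult_closed)
      also have "\<dots> = (a \<otimes>\<^bsub>skew\<^esub> c \<oplus>\<^bsub>skew\<^esub> b \<otimes>\<^bsub>skew\<^esub> c) k"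
        using skew_mult[OF 3(1,3) k S] skew_mult[OF 3(2,3) k S] by simp
      finally show "((a \<oplus>\<^bsub>skew\<^esub> b) \<otimes>\<^bsub>skew\<^esub> c) k = (a \<otimes>\<^bsub>skew\<^esub> c \<oplus>\<^bsub>skew\<^esub> b \<otimes>\<^bsub>skew\<^esub> c) k" .
    qed (use 3 in \<open>auto intro!: skew_mult_closed\<close>)
  next
    case (4 a b c)
    let ?S = "{g \<in> Arr G. a g \<noteq> \<zero>\<^bsub>A\<^esub>}"
    have S: "finite ?S" "?S \<subseteq> Arr G" using 4 skew_memD(4) by auto
    show ?case
    proof (rule skew_eqI)
      fix k assume k: "k \<in> Arr G"
      let ?e = "\<lambda>c g. ext_act g (c (ginv\<^bsub>G\<^esub> g \<cdot>\<^bsub>G\<^esub> k))" and ?Sk = "{g \<in> ?S. tgt\<^bsub>G\<^esub> g = tgt\<^bsub>G\<^esub> k}"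
      have "(a \<otimes>\<^bsub>skew\<^esub> (b \<oplus>\<^bsub>skew\<^esub> c)) k = finsum A (\<lambda>g. a g \<otimes>\<^bsub>A\<^esub> ?e (b \<oplus>\<^bsub>skew\<^esub> c) g) ?Sk"
        using skew_mult[OF 4(1) _ k S, of "b \<oplus>\<^bsub>skew\<^esub> c"] 4 by simp
      also have "\<dots> = finsum A (\<lambda>g. a g \<otimes>\<^bsub>A\<^esub> ?e b g \<oplus>\<^bsub>A\<^esub> a g \<otimes>\<^bsub>A\<^esub> ?e c g) ?Sk"
        using 4 by (intro finsum_cong') (auto simp: skew_memD right_distrib ext_act_add mult_closed)
      also have "\<dots> = finsum A (\<lambda>g. a g \<otimes>\<^bsub>A\<^esub> ?e b g) ?Sk \<oplus>\<^bsub>A\<^esub> finsum A (\<lambda>g. a g \<otimes>\<^bsub>A\<^esub> ?e c g) ?Sk"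
        using 4 by (intro finsum_addf) (auto simp: skew_memD mult_closed)
      also have "\<dots> = (a \<otimes>\<^bsub>skew\<^esub> b \<oplus>\<^bsub>skew\<^esub> a \<otimes>\<^bsub>skew\<^esub> c) k"
        using skew_mult[OF 4(1,2) k S] skew_mult[OF 4(1,3) k S] by simp
      finally show "(a \<otimes>\<^bsub>skew\<^esub> (b \<oplus>\<^bsub>skew\<^esub> c)) k = (a \<otimes>\<^bsub>skew\<^esub> b \<oplus>\<^bsub>skew\<^esub> a \<otimes>\<^bsub>skew\<^esub> c) k" .
    qed (use 4 in \<open>auto intro!: skew_mult_closed\<close>)
  qed
qed

end

text \<open>Since \<open>f\<close> maps onto the carrier of \<open>S\<close>, each law of
  \<open>S\<close> is the image of the same law of \<open>R\<close>; no axiom of \<open>S\<close>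
  has to be known in advance.\<close>

lemma ring_isomorphism_transport:
  assumes "nonunital_ring R" "bij_betw f (carrier R) (carrier S)" "f \<zero>\<^bsub>R\<^esub> = \<zero>\<^bsub>S\<^esub>"
    and add: "\<And>a b. \<lbrakk>a \<in> carrier R; b \<in> carrier R\<rbrakk> \<Longrightarrow> f (a \<oplus>\<^bsub>R\<^esub> b) = f a \<oplus>\<^bsub>S\<^esub> f b"
    and mult: "\<And>a b. \<lbrakk>a \<in> carrier R; b \<in> carrier R\<rbrakk> \<Longrightarrow> f (a \<otimes>\<^bsub>R\<^esub> b) = f a \<otimes>\<^bsub>S\<^esub> f b"
  shows "ring_isomorphism R S f"
proof -
  interpret R: nonunital_ring R by fact
  have car: "carrier S = f ` carrier R"
    using bij_betw_imp_surj_on[OF assms(2)] by simp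
  have closed: "a \<oplus>\<^bsub>S\<^esub> b \<in> carrier S" "a \<otimes>\<^bsub>S\<^esub> b \<in> carrier S"
    if ab: "a \<in> carrier S" "b \<in> carrier S" for a b
  proof -
    obtain a' b' where "a' \<in> carrier R" "b' \<in> carrier R" "a = f a'" "b = f b'"
      using ab unfolding car by blast
    then show "a \<oplus>\<^bsub>S\<^esub> b \<in> carrier S" "a \<otimes>\<^bsub>S\<^esub> b \<in> carrier S"
      unfolding car using add[of a' b', symmetric] mult[of a' b', symmetric] R.mult_closed[of a' b']
      by auto
  qed
  have zero: "\<zero>\<^bsub>S\<^esub> \<in> carrier S"
    unfolding car assms(3)[symmetric] by (rule imageI) (rule R.zero_closed)
  have S: "abelian_group S"
  proof (rule abelian_groupI, goal_cases)
    case (3 a b c)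
    then obtain a' b' c' where "a' \<in> carrier R" "b' \<in> carrier R" "c' \<in> carrier R"
        "a = f a'" "b = f b'" "c = f c'"
      unfolding car by blast
    then show ?case by (simp add: R.a_assoc add[symmetric])
  next
    case (4 a b)
    then obtain a' b' where "a' \<in> carrier R" "b' \<in> carrier R" "a = f a'" "b = f b'"
      unfolding car by blast
    then show ?case using add[of a' b'] add[of b' a'] by (simp add: R.a_comm)
  next
    case (5 a)
    then obtain a' where "a' \<in> carrier R" "a = f a'" unfolding car by blast
    then show ?case using add[of "\<zero>\<^bsub>R\<^esub>" a'] assms(3) by simp
  next
    case (6 a)
    then obtain a' where "a' \<in> carrier R" "a = f a'" unfolding car by blast
    then show ?case
      using add[of "\<ominus>\<^bsub>R\<^esub> a'" a'] assms(3)
      by (intro bexI[of _ "f (\<ominus>\<^bsub>R\<^esub> a')"]) (auto simp: car R.l_neg)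
  qed (use closed zero in auto)
  have "nonunital_ring S"
  proof (intro nonunital_ring.intro nonunital_ring_axioms.intro, goal_cases)
    case (3 a b c)
    then obtain a' b' c' where "a' \<in> carrier R" "b' \<in> carrier R" "c' \<in> carrier R"
        "a = f a'" "b = f b'" "c = f c'"
      unfolding car by blast
    then show ?case by (simp add: R.mult_assoc R.mult_closed mult[symmetric])
  next
    case (4 a b c)
    then obtain a' b' c' where "a' \<in> carrier R" "b' \<in> carrier R" "c' \<in> carrier R"
        "a = f a'" "b = f b'" "c = f c'"
      unfolding car by blast
    then show ?case by (simp add: R.left_distrib R.mult_closed add[symmetric] mult[symmetric])
  next
    case (5 a b c)
    then obtain a' b' c' where "a' \<in> carrier R" "b' \<in> carrier R" "c' \<in> carrier R"
        "a = f a'" "b = f b'" "c = f c'"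
      unfolding car by blast
    then show ?case by (simp add: R.right_distrib R.mult_closed add[symmetric] mult[symmetric])
  qed (use S closed in auto)
  then show ?thesis
    using assms by (intro ring_isomorphism.intro ring_isomorphism_axioms.intro) auto
qed

section \<open>Ideals of composites, and decomposition into homogeneous terms\<close>

context unital_partial_action
begin

text \<open>The preimage of \<open>a\<close> under \<open>\<alpha> g\<close> lies in
  \<open>D (src g)\<close>, which is \<open>D (tgt h)\<close> and hence inside \<open>D h\<close>;
  so \<open>act_restricts\<close> applies to it.\<close>

lemma D_subset_cmp:
  assumes "g \<in> Arr G" "h \<in> Arr G" "src\<^bsub>G\<^esub> g = tgt\<^bsub>G\<^esub> h" "D (tgt\<^bsub>G\<^esub> h) \<subseteq> D h"
  shows "D g \<subseteq> D (g \<cdot>\<^bsub>G\<^esub> h)"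
proof
  fix a assume a: "a \<in> D g"
  let ?b = "\<alpha> (ginv\<^bsub>G\<^esub> g) a"
  have b: "?b \<in> D (ginv\<^bsub>G\<^esub> g)"
    using act_closed[of "ginv\<^bsub>G\<^esub> g" a] a assms by simp
  then have "?b \<in> D h"
    using D_subset_tgt[of "ginv\<^bsub>G\<^esub> g"] assms by auto
  with b show "a \<in> D (g \<cdot>\<^bsub>G\<^esub> h)"
    using act_restricts[of g h ?b] act_inverse[of g a] a assms by simp
qed

text \<open>Because the domain and range of \<open>\<alpha> g\<close> are as large as possible,
  \<open>act_restricts\<close> can be used without loss for \<open>g\<close> and for its inverse,
  one for each inclusion.\<close>

lemma image_act:
  assumes "g \<in> Arr G" "h \<in> Arr G" "src\<^bsub>G\<^esub> g = tgt\<^bsub>G\<^esub> h"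
    and full: "D (ginv\<^bsub>G\<^esub> g) = D (src\<^bsub>G\<^esub> g)" "D g = D (tgt\<^bsub>G\<^esub> g)"
  shows "\<alpha> g ` D h = D (g \<cdot>\<^bsub>G\<^esub> h)"
proof
  show "\<alpha> g ` D h \<subseteq> D (g \<cdot>\<^bsub>G\<^esub> h)"
    using act_restricts[of g h] D_subset_tgt[of h] assms by auto
  show "D (g \<cdot>\<^bsub>G\<^esub> h) \<subseteq> \<alpha> g ` D h"
  proof
    fix a assume a: "a \<in> D (g \<cdot>\<^bsub>G\<^esub> h)"
    then have "a \<in> D g"
      using D_subset_tgt[of "g \<cdot>\<^bsub>G\<^esub> h"] assms by auto
    then have "\<alpha> (ginv\<^bsub>G\<^esub> g) a \<in> D h" "a = \<alpha> g (\<alpha> (ginv\<^bsub>G\<^esub> g) a)"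
      using act_restricts[of "ginv\<^bsub>G\<^esub> g" "g \<cdot>\<^bsub>G\<^esub> h" a] a assms act_inverse by auto
    then show "a \<in> \<alpha> g ` D h" by blast
  qed
qed

lemma delta_in_skew:
  assumes "g \<in> Arr G" "a \<in> D g" shows "delta A a g \<in> carrier skew"
proof (rule skew_carrierI)
  have "{k \<in> Arr G. delta A a g k \<noteq> \<zero>\<^bsub>A\<^esub>} \<subseteq> {g}"
    by (auto simp: delta_def)
  then show "finite {k \<in> Arr G. delta A a g k \<noteq> \<zero>\<^bsub>A\<^esub>}"
    by (rule finite_subset) simp
qed (use assms in \<open>auto simp: delta_def\<close>)

lemma skew_zero [simp]: "\<zero>\<^bsub>skew\<^esub> = (\<lambda>_. \<zero>\<^bsub>A\<^esub>)"
  by (simp add: skew_ring_def)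

text \<open>Evaluation at an arrow \<open>k\<close> is additive, so the sum can be computed
  coefficientwise, where only the term \<open>g = k\<close> can contribute.\<close>

lemma skew_expansion:
  assumes f: "f \<in> carrier skew"
  shows "finsum skew (\<lambda>g. delta A (f g) g) {g \<in> Arr G. f g \<noteq> \<zero>\<^bsub>A\<^esub>} = f"
proof
  let ?S = "{g \<in> Arr G. f g \<noteq> \<zero>\<^bsub>A\<^esub>}"
  interpret S: abelian_group skew by (rule skew_abelian_group)
  fix k
  have "finsum skew (\<lambda>g. delta A (f g) g) ?S k = finsum A (\<lambda>g. delta A (f g) g k) ?S"
    using skew_memD(4)[OF f] skew_memD(1)[OF f] skew_memD(3)
    by (intro additive_finsum[where h = "\<lambda>c. c k"])
       (auto simp: delta_in_skew abelian_monoid_axioms S.abelian_monoid_axioms)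
  also have "\<dots> = f k"
  proof (cases "k \<in> ?S")
    case True
    then show ?thesis
      using finsum_singleton[OF True skew_memD(4)[OF f], of f] skew_memD(3)[OF f]
      by (simp add: delta_def)
  next
    case False
    then show ?thesis
      using skew_memD(2)[OF f, of k] by (cases "k \<in> Arr G") (auto simp: delta_def intro!: add.finprod_one_eqI)
  qed
  finally show "finsum skew (\<lambda>g. delta A (f g) g) ?S k = f k" .
qed

end

section \<open>The isomorphism\<close>

locale global_transversal = unital_partial_action G A D \<alpha>
  for G :: "'g groupoid" and A :: "('a, 'm) ring_scheme" and D \<alpha> +
  fixes x :: 'g and \<tau> :: "'g \<Rightarrow> 'g"
  assumes finite_Obj: "finite (Obj G)"
    and x_Obj: "x \<in> Obj G"
    and transversal: "transversal G x \<tau>"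
    and full: "transversal_global G D x \<tau>"
begin

abbreviation H :: "'g set" where
  "H \<equiv> hom_set G x x"

abbreviation star :: "('g \<times> 'g \<Rightarrow> 'a) ring" where
  "star \<equiv> star_ring G A D \<alpha> \<tau>"

abbreviation theta_rng :: "('g \<Rightarrow> 'g \<times> 'g \<Rightarrow> 'a) ring" where
  "theta_rng \<equiv> theta_ring G A D \<alpha> x \<tau>"

text \<open>For \<open>h\<close> in the isotropy group, the inverse of \<open>g \<mapsto> (g\<^sub>x, (s(g), t(g)))\<close>.\<close>

definition arrow :: "'g \<Rightarrow> 'g \<times> 'g \<Rightarrow> 'g" where
  "arrow h u = \<tau> (snd u) \<cdot>\<^bsub>G\<^esub> h \<cdot>\<^bsub>G\<^esub> ginv\<^bsub>G\<^esub> (\<tau> (fst u))"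

lemma tau [simp]:
  assumes "y \<in> Obj G"
  shows "\<tau> y \<in> Arr G" "src\<^bsub>G\<^esub> (\<tau> y) = x" "tgt\<^bsub>G\<^esub> (\<tau> y) = y"
  using transversal assms by (auto simp: transversal_def hom_set_def)

lemma D_tau [simp]: "y \<in> Obj G \<Longrightarrow> D (\<tau> y) = D y"
  and D_ginv_tau [simp]: "y \<in> Obj G \<Longrightarrow> D (ginv\<^bsub>G\<^esub> (\<tau> y)) = D x"
  using full by (auto simp: transversal_global_def)

lemma H_D [simp]:
  assumes "h \<in> H" shows "h \<in> Arr G" "src\<^bsub>G\<^esub> h = x" "tgt\<^bsub>G\<^esub> h = x"
  using assms by (auto simp: hom_set_def)

lemma H_I: "\<lbrakk>h \<in> Arr G; src\<^bsub>G\<^esub> h = x; tgt\<^bsub>G\<^esub> h = x\<rbrakk> \<Longrightarrow> h \<in> H"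
  by (simp add: hom_set_def del: H_D)

lemma x_simps [simp]: "x \<in> Arr G" "src\<^bsub>G\<^esub> x = x" "tgt\<^bsub>G\<^esub> x = x"
  using x_Obj by simp_all

lemma arrow [simp]:
  assumes "h \<in> H" "y \<in> Obj G" "z \<in> Obj G"
  shows "arrow h (y, z) \<in> Arr G" "src\<^bsub>G\<^esub> (arrow h (y, z)) = y" "tgt\<^bsub>G\<^esub> (arrow h (y, z)) = z"
  using assms by (simp_all add: arrow_def)

lemma to_isotropy_in_H [simp]: "g \<in> Arr G \<Longrightarrow> to_isotropy G \<tau> g \<in> H"
  by (intro H_I) (simp_all add: to_isotropy_def)

lemma arrow_to_isotropy [simp]:
  "g \<in> Arr G \<Longrightarrow> arrow (to_isotropy G \<tau> g) (src\<^bsub>G\<^esub> g, tgt\<^bsub>G\<^esub> g) = g"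
  by (simp add: arrow_def to_isotropy_def cmp_assoc)

lemma to_isotropy_arrow [simp]:
  "\<lbrakk>h \<in> H; y \<in> Obj G; z \<in> Obj G\<rbrakk> \<Longrightarrow> to_isotropy G \<tau> (arrow h (y, z)) = h"
  unfolding to_isotropy_def by (simp add: arrow_def cmp_assoc)

lemma H_cmp [simp]: "\<lbrakk>g \<in> H; h \<in> H\<rbrakk> \<Longrightarrow> g \<cdot>\<^bsub>G\<^esub> h \<in> H"
  and H_ginv [simp]: "g \<in> H \<Longrightarrow> ginv\<^bsub>G\<^esub> g \<in> H"
  by (intro H_I; simp)+

text \<open>The factors \<open>\<tau> z\<close> cancel. Division in \<open>G\<close> thus splits
  into division of \<open>(y, z)\<close> by \<open>(r, z)\<close> in the pair groupoid and of
  \<open>k\<close> by \<open>g\<close> in the isotropy group.\<close>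

lemma arrow_ginv_cmp:
  assumes "g \<in> H" "k \<in> H" "y \<in> Obj G" "z \<in> Obj G" "r \<in> Obj G"
  shows "ginv\<^bsub>G\<^esub> (arrow g (r, z)) \<cdot>\<^bsub>G\<^esub> arrow k (y, z) = arrow (ginv\<^bsub>G\<^esub> g \<cdot>\<^bsub>G\<^esub> k) (y, r)"
  using assms by (simp add: arrow_def ginv_of_cmp cmp_assoc)

section \<open>Ideals and identities along the transversal\<close>

lemma D_subset_x: "h \<in> H \<Longrightarrow> D h \<subseteq> D x"
  using D_subset_tgt[of h] by simp

text \<open>Composing with \<open>ginv (\<tau> y)\<close> can only enlarge the ideal, since the
  ideal of that arrow is full. The same holds for composing back with
  \<open>\<tau> y\<close>.\<close>

lemma D_cmp_ginv_tau:
  assumes "k \<in> Arr G" "src\<^bsub>G\<^esub> k = x" "y \<in> Obj G"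
  shows "D (k \<cdot>\<^bsub>G\<^esub> ginv\<^bsub>G\<^esub> (\<tau> y)) = D k"
  using D_subset_cmp[of k "ginv\<^bsub>G\<^esub> (\<tau> y)"] D_subset_cmp[of "k \<cdot>\<^bsub>G\<^esub> ginv\<^bsub>G\<^esub> (\<tau> y)" "\<tau> y"] assms
  by (simp add: cmp_assoc)

lemma D_arrow: "\<lbrakk>h \<in> H; y \<in> Obj G; z \<in> Obj G\<rbrakk> \<Longrightarrow> D (arrow h (y, z)) = D (\<tau> z \<cdot>\<^bsub>G\<^esub> h)"
  by (simp add: arrow_def D_cmp_ginv_tau)

lemma image_tau: "\<lbrakk>h \<in> H; y \<in> Obj G; z \<in> Obj G\<rbrakk> \<Longrightarrow> \<alpha> (\<tau> z) ` D h = D (arrow h (y, z))"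
  by (simp add: D_arrow image_act)

lemma idem_absorb:
  assumes "g \<in> Arr G" "h \<in> Arr G" "D h \<subseteq> D g"
  shows "idem g \<otimes>\<^bsub>A\<^esub> idem h = idem h"
  using assms idem_left[of g "idem h"] idem_in_D[of h] by auto

text \<open>\<open>act_idem\<close> leaves a factor \<open>idem (\<tau> z)\<close>, which is
  absorbed because the ideal of the arrow is contained in \<open>D z\<close>. The source
  \<open>y\<close> does not affect that ideal.\<close>

lemma ext_act_tau_idem:
  assumes "h \<in> H" "y \<in> Obj G" "z \<in> Obj G"
  shows "ext_act (\<tau> z) (idem h) = idem (arrow h (y, z))"
  using assms D_subset_tgt[of "\<tau> z \<cdot>\<^bsub>G\<^esub> h"]
  by (simp add: ext_act_idem idem_absorb D_arrow)

lemma ext_act_ginv_tau_idem: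
  assumes "h \<in> H" "y \<in> Obj G" "z \<in> Obj G"
  shows "ext_act (ginv\<^bsub>G\<^esub> (\<tau> z)) (idem (arrow h (y, z))) = idem h"
proof -
  have "ginv\<^bsub>G\<^esub> (\<tau> z) \<cdot>\<^bsub>G\<^esub> arrow h (y, z) = h \<cdot>\<^bsub>G\<^esub> ginv\<^bsub>G\<^esub> (\<tau> y)"
    using assms by (simp add: arrow_def cmp_assoc)
  then show ?thesis
    using assms D_subset_x[of h] idem_absorb[of x h]
    by (simp add: ext_act_idem D_cmp_ginv_tau)
qed

lemma ext_act_ginv_tau_tau:
  assumes "z \<in> Obj G" "a \<in> D x"
  shows "ext_act (ginv\<^bsub>G\<^esub> (\<tau> z)) (ext_act (\<tau> z) a) = a"
  using assms act_inverse'[of "\<tau> z" a] act_closed[of "\<tau> z" a] by (simp add: ext_act_eq)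

lemma ext_act_tau_ginv_tau:
  assumes "z \<in> Obj G" "a \<in> D z"
  shows "ext_act (\<tau> z) (ext_act (ginv\<^bsub>G\<^esub> (\<tau> z)) a) = a"
  using assms act_inverse[of "\<tau> z" a] act_closed[of "ginv\<^bsub>G\<^esub> (\<tau> z)" a] by (simp add: ext_act_eq)

text \<open>The factor \<open>a\<close> lies in the ideals of both \<open>\<tau> z\<close> and
  \<open>\<tau> z \<cdot> g\<close>, so the three maps can be fused in two steps.\<close>

lemma mult_ext_act_arrow:
  assumes "g \<in> H" "r \<in> Obj G" "z \<in> Obj G" "a \<in> D (arrow g (r, z))" "b \<in> carrier A"
  shows "a \<otimes>\<^bsub>A\<^esub> ext_act (\<tau> z) (ext_act g (ext_act (ginv\<^bsub>G\<^esub> (\<tau> r)) b)) = a \<otimes>\<^bsub>A\<^esub> ext_act (arrow g (r, z)) b"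
proof -
  have a: "a \<in> D (\<tau> z \<cdot>\<^bsub>G\<^esub> g)" "a \<in> D (\<tau> z)"
    using assms D_subset_tgt[of "arrow g (r, z)"] by (auto simp: D_arrow)
  have "a \<otimes>\<^bsub>A\<^esub> ext_act (\<tau> z) (ext_act g (ext_act (ginv\<^bsub>G\<^esub> (\<tau> r)) b))
      = a \<otimes>\<^bsub>A\<^esub> ext_act (\<tau> z \<cdot>\<^bsub>G\<^esub> g) (ext_act (ginv\<^bsub>G\<^esub> (\<tau> r)) b)"
    using assms a by (intro mult_ext_act_ext_act) simp_all
  also have "\<dots> = a \<otimes>\<^bsub>A\<^esub> ext_act (arrow g (r, z)) b"
    using assms a by (subst mult_ext_act_ext_act) (simp_all add: arrow_def)
  finally show ?thesis .
qed

subsection \<open>The ring of the pair groupoid\<close>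

lemma star_zero [simp]: "\<zero>\<^bsub>star\<^esub> = (\<lambda>_. \<zero>\<^bsub>A\<^esub>)"
  and star_add [simp]: "c \<oplus>\<^bsub>star\<^esub> d = (\<lambda>u. c u \<oplus>\<^bsub>A\<^esub> d u)"
  by (simp_all add: star_ring_def skew_ring_def)

lemma Arr_pair [simp]: "Arr (pair_groupoid G) = Obj G \<times> Obj G"
  by (simp add: pair_groupoid_def)

text \<open>With finitely many objects the finite support condition is automatic.\<close>

lemma star_carrier_iff:
  "c \<in> carrier star \<longleftrightarrow>
    (\<forall>y\<in>Obj G. \<forall>z\<in>Obj G. c (y, z) \<in> D z) \<and> (\<forall>u. u \<notin> Obj G \<times> Obj G \<longrightarrow> c u = \<zero>\<^bsub>A\<^esub>)"
proof -
  have "finite {u \<in> Obj G \<times> Obj G. c u \<noteq> \<zero>\<^bsub>A\<^esub>}"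
    using finite_Obj by simp
  then show ?thesis
    by (auto simp: star_ring_def skew_ring_def star_ideal_def)
qed

lemma star_value_closed: "c \<in> carrier star \<Longrightarrow> c u \<in> carrier A"
  using D_carrier[of "snd u" "c u"]
  by (cases u; cases "u \<in> Obj G \<times> Obj G") (auto simp: star_carrier_iff)

lemma star_abelian_group: "abelian_group star"
  unfolding star_ring_def
  by (rule skew_ring_abelian_group) (auto simp: abelian_group_axioms star_ideal_def intro!: D_additive)

text \<open>Matrix multiplication twisted by the action: the factorizations of \<open>(y, z)\<close>
  are \<open>(r, z)\<close> after \<open>(y, r)\<close>, one for each object
  \<open>r\<close>.\<close>

lemma star_mult:
  assumes c: "c \<in> carrier star" and d: "d \<in> carrier star"
  shows "c \<otimes>\<^bsub>star\<^esub> d = (\<lambda>u. if u \<in> Obj G \<times> Obj G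
    then finsum A (\<lambda>r. c (r, snd u) \<otimes>\<^bsub>A\<^esub> ext_act (\<tau> (snd u)) (ext_act (ginv\<^bsub>G\<^esub> (\<tau> r)) (d (fst u, r)))) (Obj G)
    else \<zero>\<^bsub>A\<^esub>)"
proof
  fix u
  let ?P = "pair_groupoid G"
  let ?T = "{(v, w). v \<in> Arr ?P \<and> w \<in> Arr ?P \<and> src\<^bsub>?P\<^esub> v = tgt\<^bsub>?P\<^esub> w \<and> v \<cdot>\<^bsub>?P\<^esub> w = u \<and>
      c v \<noteq> \<zero>\<^bsub>A\<^esub> \<and> d w \<noteq> \<zero>\<^bsub>A\<^esub>}"
  let ?F = "\<lambda>v w. c v \<otimes>\<^bsub>A\<^esub> ext_act (\<tau> (snd v)) (ext_act (ginv\<^bsub>G\<^esub> (\<tau> (fst v))) (d w))"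
  interpret P: groupoid ?P by (rule groupoid_pair_groupoid) (rule groupoid_axioms)
  have closed: "?F (r, z) w \<in> carrier A" if "r \<in> Obj G" "z \<in> Obj G" for r z w
    using that by (auto simp: mult_closed star_value_closed[OF c] star_value_closed[OF d])
  have "(c \<otimes>\<^bsub>star\<^esub> d) u = finsum A (\<lambda>(v, w). c v \<otimes>\<^bsub>A\<^esub>
      star_act G \<alpha> \<tau> v (d w \<otimes>\<^bsub>A\<^esub> identity_of A (star_ideal D (ginv\<^bsub>?P\<^esub> v)))) ?T"
    by (simp add: star_ring_def skew_ring_def)
  also have "\<dots> = finsum A (\<lambda>(v, w). ?F v w) ?T"
  proof (intro finsum_cong' refl)
    show "(\<lambda>(v, w). ?F v w) \<in> ?T \<rightarrow> carrier A"
      using closed by (auto simp: pair_groupoid_def)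
    fix vw assume "vw \<in> ?T"
    then obtain y r z where vw: "vw = ((r, z), (y, r))" "y \<in> Obj G" "r \<in> Obj G" "z \<in> Obj G"
      by (auto simp: pair_groupoid_def)
    have dr: "d (y, r) \<in> D r" using d vw by (auto simp: star_carrier_iff)
    have "star_act G \<alpha> \<tau> (r, z) (d (y, r)) = ext_act (\<tau> z) (ext_act (ginv\<^bsub>G\<^esub> (\<tau> r)) (d (y, r)))"
      using vw dr act_closed[of "ginv\<^bsub>G\<^esub> (\<tau> r)" "d (y, r)"] by (simp add: star_act_def ext_act_eq)
    \<comment> \<open>The inverse of \<open>(r, z)\<close> is \<open>(z, r)\<close>, whose ideal is
      \<open>D r\<close>; its identity fixes \<open>d (y, r)\<close>.\<close>
    then show "(case vw of (v, w) \<Rightarrow> c v \<otimes>\<^bsub>A\<^esub>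
        star_act G \<alpha> \<tau> v (d w \<otimes>\<^bsub>A\<^esub> identity_of A (star_ideal D (ginv\<^bsub>?P\<^esub> v)))) = (case vw of (v, w) \<Rightarrow> ?F v w)"
      using vw dr by (simp add: ginv_pair_groupoid groupoid_axioms star_ideal_def)
  qed
  also have "\<dots> = (if u \<in> Obj G \<times> Obj G
    then finsum A (\<lambda>r. c (r, snd u) \<otimes>\<^bsub>A\<^esub> ext_act (\<tau> (snd u)) (ext_act (ginv\<^bsub>G\<^esub> (\<tau> r)) (d (fst u, r)))) (Obj G)
    else \<zero>\<^bsub>A\<^esub>)"
  proof (cases "u \<in> Obj G \<times> Obj G")
    case True
    then obtain y z where u: "u = (y, z)" "y \<in> Obj G" "z \<in> Obj G" by auto
    have "finsum A (\<lambda>(v, w). ?F v w) ?T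
        = finsum A (\<lambda>v. ?F v (ginv\<^bsub>?P\<^esub> v \<cdot>\<^bsub>?P\<^esub> u)) {v \<in> Arr ?P. tgt\<^bsub>?P\<^esub> v = tgt\<^bsub>?P\<^esub> u}"
      using True finite_Obj c d closed
      by (intro P.finsum_factorizations)
         (auto simp: abelian_monoid_axioms mult_zero_left mult_zero_right star_value_closed)
    also have "{v \<in> Arr ?P. tgt\<^bsub>?P\<^esub> v = tgt\<^bsub>?P\<^esub> u} = (\<lambda>r. (r, z)) ` Obj G"
      using u by (auto simp: pair_groupoid_def)
    also have "finsum A (\<lambda>v. ?F v (ginv\<^bsub>?P\<^esub> v \<cdot>\<^bsub>?P\<^esub> u)) \<dots>
        = finsum A (\<lambda>r. ?F (r, z) (ginv\<^bsub>?P\<^esub> (r, z) \<cdot>\<^bsub>?P\<^esub> u)) (Obj G)"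
      using u by (intro finsum_reindex) (auto simp: inj_on_def intro!: closed[simplified])
    also have "\<dots> = finsum A (\<lambda>r. ?F (r, z) (y, r)) (Obj G)"
    proof (intro finsum_cong' refl)
      show "(\<lambda>r. ?F (r, z) (y, r)) \<in> Obj G \<rightarrow> carrier A"
        using u by (auto intro!: closed[simplified])
      fix r assume "r \<in> Obj G"
      then have "ginv\<^bsub>?P\<^esub> (r, z) \<cdot>\<^bsub>?P\<^esub> u = (y, r)"
        using u by (simp add: ginv_pair_groupoid groupoid_axioms) (simp add: pair_groupoid_def)
      then show "?F (r, z) (ginv\<^bsub>?P\<^esub> (r, z) \<cdot>\<^bsub>?P\<^esub> u) = ?F (r, z) (y, r)" by simp
    qed
    finally show ?thesis using True u by simp
  next
    case False
    then have T: "?T = {}" by (auto simp: pair_groupoid_def)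
    show ?thesis unfolding T using False by simp
  qed
  finally show "(c \<otimes>\<^bsub>star\<^esub> d) u = \<dots>" .
qed

lemma star_mult_closed:
  assumes "c \<in> carrier star" "d \<in> carrier star"
  shows "c \<otimes>\<^bsub>star\<^esub> d \<in> carrier star"
proof -
  have "c (r, z) \<otimes>\<^bsub>A\<^esub> ext_act (\<tau> z) (ext_act (ginv\<^bsub>G\<^esub> (\<tau> r)) (d v)) \<in> D z"
    if "r \<in> Obj G" "z \<in> Obj G" for r z v
    using that assms by (intro D_mult_right) (simp_all add: star_carrier_iff star_value_closed[OF assms(2)])
  then have "finsum A (\<lambda>r. c (r, z) \<otimes>\<^bsub>A\<^esub> ext_act (\<tau> z) (ext_act (ginv\<^bsub>G\<^esub> (\<tau> r)) (d (y, r)))) (Obj G) \<in> D z"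
    if "z \<in> Obj G" for y z
    using that by (intro D_finsum) simp_all
  then show ?thesis
    by (auto simp: star_mult[OF assms] star_carrier_iff)
qed

section \<open>The ideals of the isotropy action, their identities, and the extended action\<close>

lemma D_arrow_subset: "\<lbrakk>h \<in> H; y \<in> Obj G; z \<in> Obj G\<rbrakk> \<Longrightarrow> D (arrow h (y, z)) \<subseteq> D z"
  using D_subset_tgt[of "arrow h (y, z)"] by simp

text \<open>The image of \<open>D h\<close> under \<open>\<alpha> (\<tau> z)\<close> is the ideal of
  \<open>\<tau> z \<cdot> h\<close>, and therefore that of \<open>arrow h (y, z)\<close> for every
  source \<open>y\<close>.\<close>

lemma theta_ideal_iff:
  assumes "h \<in> H"
  shows "c \<in> theta_ideal G A D \<alpha> \<tau> h \<longleftrightarrow>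
    c \<in> carrier star \<and> (\<forall>y\<in>Obj G. \<forall>z\<in>Obj G. c (y, z) \<in> D (arrow h (y, z)))"
  using assms by (auto simp: theta_ideal_def image_act D_arrow)

text \<open>The diagonal element whose entry at \<open>(z, z)\<close> is the image of
  \<open>idem h\<close> under \<open>\<alpha> (\<tau> z)\<close>, written as the identity of the
  ideal of the conjugated arrow.\<close>

definition theta_one :: "'g \<Rightarrow> 'g \<times> 'g \<Rightarrow> 'a" where
  "theta_one h = (\<lambda>u. if u \<in> Obj G \<times> Obj G \<and> fst u = snd u then idem (arrow h u) else \<zero>\<^bsub>A\<^esub>)"

lemma theta_one_in_star: assumes "h \<in> H" shows "theta_one h \<in> carrier star"
  using assms D_arrow_subset idem_in_D by (fastforce simp: star_carrier_iff theta_one_def)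

text \<open>Only the intermediate object \<open>r = y\<close> contributes. The diagonal entry there
  is pulled back to \<open>idem h\<close> at \<open>x\<close> and pushed forward to the identity
  belonging to \<open>arrow h (y, z)\<close>.\<close>

lemma star_mult_theta_one:
  assumes h: "h \<in> H" and c: "c \<in> carrier star"
  shows "c \<otimes>\<^bsub>star\<^esub> theta_one h
    = (\<lambda>u. if u \<in> Obj G \<times> Obj G then c u \<otimes>\<^bsub>A\<^esub> idem (arrow h u) else \<zero>\<^bsub>A\<^esub>)"
proof -
  have "finsum A (\<lambda>r. c (r, z) \<otimes>\<^bsub>A\<^esub> ext_act (\<tau> z) (ext_act (ginv\<^bsub>G\<^esub> (\<tau> r)) (theta_one h (y, r)))) (Obj G)
      = c (y, z) \<otimes>\<^bsub>A\<^esub> idem (arrow h (y, z))" (is "?L = ?R") if "y \<in> Obj G" "z \<in> Obj G" for y z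
  proof -
    have "?L = finsum A (\<lambda>r. if y = r then c (r, z) \<otimes>\<^bsub>A\<^esub> idem (arrow h (r, z)) else \<zero>\<^bsub>A\<^esub>) (Obj G)"
    proof (intro finsum_cong' refl)
      fix r assume "r \<in> Obj G"
      then show "c (r, z) \<otimes>\<^bsub>A\<^esub> ext_act (\<tau> z) (ext_act (ginv\<^bsub>G\<^esub> (\<tau> r)) (theta_one h (y, r)))
          = (if y = r then c (r, z) \<otimes>\<^bsub>A\<^esub> idem (arrow h (r, z)) else \<zero>\<^bsub>A\<^esub>)"
        using that h by (auto simp: theta_one_def ext_act_ginv_tau_idem ext_act_tau_idem[of h r z]
            mult_zero_right star_value_closed[OF c])
    qed (use that h in \<open>auto simp: mult_closed star_value_closed[OF c]\<close>)
    also have "\<dots> = ?R"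
      using finsum_singleton[OF that(1) finite_Obj, of "\<lambda>r. c (r, z) \<otimes>\<^bsub>A\<^esub> idem (arrow h (r, z))"] that h
      by (simp add: Pi_def mult_closed star_value_closed[OF c])
    finally show ?thesis .
  qed
  then show ?thesis
    by (auto simp: star_mult[OF c theta_one_in_star[OF h]])
qed

text \<open>Only \<open>r = z\<close> contributes. The ideal of \<open>arrow h (y, z)\<close> is
  independent of \<open>y\<close>, so the diagonal entry at \<open>(z, z)\<close> fixes
  \<open>c (y, z)\<close>.\<close>

lemma theta_one_star_mult:
  assumes h: "h \<in> H" and c: "c \<in> theta_ideal G A D \<alpha> \<tau> h"
  shows "theta_one h \<otimes>\<^bsub>star\<^esub> c = c"
proof -
  have c': "c \<in> carrier star" "\<And>y z. \<lbrakk>y \<in> Obj G; z \<in> Obj G\<rbrakk> \<Longrightarrow> c (y, z) \<in> D (arrow h (y, z))"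
    using c h by (auto simp: theta_ideal_iff)
  have "finsum A (\<lambda>r. theta_one h (r, z) \<otimes>\<^bsub>A\<^esub> ext_act (\<tau> z) (ext_act (ginv\<^bsub>G\<^esub> (\<tau> r)) (c (y, r)))) (Obj G)
      = c (y, z)" (is "?L = _") if "y \<in> Obj G" "z \<in> Obj G" for y z
  proof -
    have "?L = finsum A (\<lambda>r. if z = r then c (y, r) else \<zero>\<^bsub>A\<^esub>) (Obj G)"
    proof (intro finsum_cong' refl)
      fix r assume r: "r \<in> Obj G"
      have "c (y, z) \<in> D z" "c (y, z) \<in> D (arrow h (z, z))"
        using that c'(2)[OF that] D_arrow_subset[OF h that] h by (auto simp: D_arrow)
      then show "theta_one h (r, z) \<otimes>\<^bsub>A\<^esub> ext_act (\<tau> z) (ext_act (ginv\<^bsub>G\<^esub> (\<tau> r)) (c (y, r)))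
          = (if z = r then c (y, r) else \<zero>\<^bsub>A\<^esub>)"
        using that h r by (auto simp: theta_one_def ext_act_tau_ginv_tau idem_left
            mult_zero_left star_value_closed[OF c'(1)])
    qed (auto simp: star_value_closed[OF c'(1)])
    also have "\<dots> = c (y, z)"
      using finsum_singleton[OF that(2) finite_Obj, of "\<lambda>r. c (y, r)"]
      by (simp add: Pi_def star_value_closed[OF c'(1)])
    finally show ?thesis .
  qed
  then show ?thesis
    using c'(1) by (auto simp: star_mult[OF theta_one_in_star[OF h] c'(1)] star_carrier_iff)
qed

lemma identity_of_theta_ideal:
  assumes h: "h \<in> H"
  shows "identity_of star (theta_ideal G A D \<alpha> \<tau> h) = theta_one h"
proof (rule identity_of_eqI)
  have "theta_one h \<in> theta_ideal G A D \<alpha> \<tau> h"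
    using h by (auto simp: theta_ideal_iff theta_one_in_star) (simp add: theta_one_def idem_in_D)
  moreover have "c \<otimes>\<^bsub>star\<^esub> theta_one h = c" if "c \<in> theta_ideal G A D \<alpha> \<tau> h" for c
  proof -
    have c': "c \<in> carrier star" "\<And>y z. \<lbrakk>y \<in> Obj G; z \<in> Obj G\<rbrakk> \<Longrightarrow> c (y, z) \<in> D (arrow h (y, z))"
      using that h by (auto simp: theta_ideal_iff)
    then show ?thesis
      using h by (auto simp: star_mult_theta_one star_carrier_iff)
  qed
  ultimately show "is_identity_of star (theta_ideal G A D \<alpha> \<tau> h) (theta_one h)"
    using h by (simp add: is_identity_of_def theta_one_star_mult)
qed

text \<open>\<open>\<theta>\<^sub>h\<close> composed with multiplication by the identity of its domain, see \<open>theta_cut\<close>.\<close>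

definition ext_theta :: "'g \<Rightarrow> ('g \<times> 'g \<Rightarrow> 'a) \<Rightarrow> 'g \<times> 'g \<Rightarrow> 'a" where
  "ext_theta h c = (\<lambda>u. if u \<in> Obj G \<times> Obj G
    then ext_act (\<tau> (snd u)) (ext_act h (ext_act (ginv\<^bsub>G\<^esub> (\<tau> (snd u))) (c u))) else \<zero>\<^bsub>A\<^esub>)"

text \<open>The element \<open>?a\<close> picked by \<open>inv_into\<close> lies in
  \<open>D x\<close>, where the map of \<open>ginv (\<tau> z)\<close> undoes that of
  \<open>\<tau> z\<close>. Hence \<open>?a\<close> is the pulled back coefficient cut down by
  \<open>idem (ginv h)\<close>, and applying \<open>\<alpha> h\<close> to it is applying
  \<open>ext_act h\<close> to the uncut one.\<close>

lemma theta_cut: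
  assumes h: "h \<in> H" and c: "c \<in> carrier star"
  shows "theta G A D \<alpha> \<tau> h (c \<otimes>\<^bsub>star\<^esub> theta_one (ginv\<^bsub>G\<^esub> h)) = ext_theta h c"
proof -
  have "\<alpha> (\<tau> z) (\<alpha> h (inv_into (D (ginv\<^bsub>G\<^esub> h)) (\<alpha> (\<tau> z)) (c (y, z) \<otimes>\<^bsub>A\<^esub> idem (arrow (ginv\<^bsub>G\<^esub> h) (y, z)))))
      = ext_act (\<tau> z) (ext_act h (ext_act (ginv\<^bsub>G\<^esub> (\<tau> z)) (c (y, z))))"
    if yz: "y \<in> Obj G" "z \<in> Obj G" for y z
  proof -
    let ?m = "arrow (ginv\<^bsub>G\<^esub> h) (y, z)" and ?e = "ext_act (ginv\<^bsub>G\<^esub> (\<tau> z)) (c (y, z))"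
    let ?c = "c (y, z) \<otimes>\<^bsub>A\<^esub> idem ?m"
    let ?a = "inv_into (D (ginv\<^bsub>G\<^esub> h)) (\<alpha> (\<tau> z)) ?c"
    \<comment> \<open>Membership in the image makes \<open>inv_into\<close> return a genuine
      preimage.\<close>
    have "?c \<in> \<alpha> (\<tau> z) ` D (ginv\<^bsub>G\<^esub> h)"
      using image_tau[of "ginv\<^bsub>G\<^esub> h" y z] h yz by (simp add: cut_in_D star_value_closed[OF c])
    then have a: "?a \<in> D (ginv\<^bsub>G\<^esub> h)" "\<alpha> (\<tau> z) ?a = ?c"
      by (simp_all add: inv_into_into f_inv_into_f)
    then have "?a \<in> D x"
      using D_subset_x[of "ginv\<^bsub>G\<^esub> h"] h by auto
    then have "?a = ext_act (ginv\<^bsub>G\<^esub> (\<tau> z)) ?c"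
      using ext_act_ginv_tau_tau[of z ?a] yz by (simp add: ext_act_eq a(2))
    also have "\<dots> = ?e \<otimes>\<^bsub>A\<^esub> idem (ginv\<^bsub>G\<^esub> h)"
      using yz h by (simp add: ext_act_mult ext_act_ginv_tau_idem star_value_closed[OF c])
    finally have "\<alpha> h ?a = ext_act h ?e"
      by (simp add: ext_act_def[of h])
    moreover have "ext_act h ?e \<in> D x"
      using ext_act_in_D[of h ?e] D_subset_x[of h] h yz star_value_closed[OF c] by auto
    ultimately show ?thesis
      using yz by (simp add: ext_act_eq[of "\<tau> z"])
  qed
  then show ?thesis
    using h by (auto simp: theta_def ext_theta_def star_mult_theta_one[OF _ c])
qed

lemma ext_theta_closed:
  assumes "h \<in> H" "c \<in> carrier star" shows "ext_theta h c \<in> carrier star"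
proof -
  have "ext_act (\<tau> z) a \<in> D z" if "z \<in> Obj G" "a \<in> carrier A" for z a
    using ext_act_in_D[of "\<tau> z" a] that by simp
  then show ?thesis
    unfolding star_carrier_iff using assms(1) star_value_closed[OF assms(2)]
    by (auto simp: ext_theta_def)
qed

subsection \<open>The isomorphism on coefficients\<close>

text \<open>A closed form of \<open>phi\<close>, see \<open>phi_eq_psi\<close>.\<close>

definition psi :: "('g \<Rightarrow> 'a) \<Rightarrow> 'g \<Rightarrow> 'g \<times> 'g \<Rightarrow> 'a" where
  "psi f = (\<lambda>h u. if h \<in> H \<and> u \<in> Obj G \<times> Obj G then f (arrow h u) else \<zero>\<^bsub>A\<^esub>)"

definition psi_inv :: "('g \<Rightarrow> 'g \<times> 'g \<Rightarrow> 'a) \<Rightarrow> 'g \<Rightarrow> 'a" where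
  "psi_inv F = (\<lambda>g. if g \<in> Arr G then F (to_isotropy G \<tau> g) (src\<^bsub>G\<^esub> g, tgt\<^bsub>G\<^esub> g) else \<zero>\<^bsub>A\<^esub>)"

lemma theta_carrier_iff:
  "F \<in> carrier theta_rng \<longleftrightarrow> (\<forall>h\<in>H. F h \<in> theta_ideal G A D \<alpha> \<tau> h) \<and>
    (\<forall>h. h \<notin> H \<longrightarrow> F h = (\<lambda>_. \<zero>\<^bsub>A\<^esub>)) \<and> finite {h \<in> H. F h \<noteq> (\<lambda>_. \<zero>\<^bsub>A\<^esub>)}"
  unfolding theta_ring_def skew_ring_def by (simp add: isotropy_def)

lemma psi_in_star:
  assumes "f \<in> carrier skew" shows "psi f h \<in> carrier star"
proof (cases "h \<in> H")
  case True
  then have "f (arrow h (y, z)) \<in> D z" if "y \<in> Obj G" "z \<in> Obj G" for y z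
    using that assms skew_memD(1)[of f "arrow h (y, z)"] D_arrow_subset[of h y z] by auto
  then show ?thesis by (auto simp: psi_def star_carrier_iff)
qed (auto simp: psi_def star_carrier_iff)

text \<open>Bounds the support of \<open>psi f\<close> by a finite set, which later also indexes the
  product in \<open>theta_rng\<close>.\<close>

lemma psi_nonzero:
  assumes "psi f h \<noteq> (\<lambda>_. \<zero>\<^bsub>A\<^esub>)"
  shows "h \<in> to_isotropy G \<tau> ` {g \<in> Arr G. f g \<noteq> \<zero>\<^bsub>A\<^esub>}"
proof -
  have "\<exists>u. psi f h u \<noteq> \<zero>\<^bsub>A\<^esub>"
    using assms by (auto simp: fun_eq_iff)
  then obtain u where "psi f h u \<noteq> \<zero>\<^bsub>A\<^esub>" ..
  then obtain y z where "h \<in> H" "y \<in> Obj G" "z \<in> Obj G" "f (arrow h (y, z)) \<noteq> \<zero>\<^bsub>A\<^esub>"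
    by (cases u) (auto simp: psi_def split: if_splits)
  then show ?thesis
    by (intro image_eqI[of _ _ "arrow h (y, z)"]) auto
qed

lemma psi_closed:
  assumes f: "f \<in> carrier skew" shows "psi f \<in> carrier theta_rng"
proof -
  have "psi f h \<in> theta_ideal G A D \<alpha> \<tau> h" if "h \<in> H" for h
    using that f psi_in_star[OF f] skew_memD(1)[OF f] by (auto simp: theta_ideal_iff) (simp add: psi_def)
  moreover have "{h \<in> H. psi f h \<noteq> (\<lambda>_. \<zero>\<^bsub>A\<^esub>)} \<subseteq> to_isotropy G \<tau> ` {g \<in> Arr G. f g \<noteq> \<zero>\<^bsub>A\<^esub>}"
    using psi_nonzero by auto
  then have "finite {h \<in> H. psi f h \<noteq> (\<lambda>_. \<zero>\<^bsub>A\<^esub>)}"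
    by (rule finite_subset) (use skew_memD(4)[OF f] in simp)
  ultimately show ?thesis
    by (auto simp: theta_carrier_iff) (auto simp: psi_def)
qed

lemma psi_inv_closed:
  assumes F: "F \<in> carrier theta_rng" shows "psi_inv F \<in> carrier skew"
proof (rule skew_carrierI)
  fix g assume g: "g \<in> Arr G"
  then have "F (to_isotropy G \<tau> g) \<in> theta_ideal G A D \<alpha> \<tau> (to_isotropy G \<tau> g)"
    using F by (simp add: theta_carrier_iff)
  then have "F (to_isotropy G \<tau> g) (src\<^bsub>G\<^esub> g, tgt\<^bsub>G\<^esub> g) \<in> D (arrow (to_isotropy G \<tau> g) (src\<^bsub>G\<^esub> g, tgt\<^bsub>G\<^esub> g))"
    unfolding theta_ideal_iff[OF to_isotropy_in_H[OF g]] using src_Obj[OF g] tgt_Obj[OF g] by blast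
  then show "psi_inv F g \<in> D g"
    using g by (simp add: psi_inv_def)
next
  let ?S = "{h \<in> H. F h \<noteq> (\<lambda>_. \<zero>\<^bsub>A\<^esub>)}"
  \<comment> \<open>Each of the finitely many \<open>h\<close> accounts for at most one arrow per
    pair of objects, and there are finitely many such pairs.\<close>
  have "{g \<in> Arr G. psi_inv F g \<noteq> \<zero>\<^bsub>A\<^esub>} \<subseteq> (\<lambda>(h, u). arrow h u) ` (?S \<times> (Obj G \<times> Obj G))"
  proof
    fix g assume "g \<in> {g \<in> Arr G. psi_inv F g \<noteq> \<zero>\<^bsub>A\<^esub>}"
    then have "g \<in> Arr G" "F (to_isotropy G \<tau> g) (src\<^bsub>G\<^esub> g, tgt\<^bsub>G\<^esub> g) \<noteq> \<zero>\<^bsub>A\<^esub>"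
      by (auto simp: psi_inv_def)
    then show "g \<in> (\<lambda>(h, u). arrow h u) ` (?S \<times> (Obj G \<times> Obj G))"
      by (intro image_eqI[of _ _ "(to_isotropy G \<tau> g, (src\<^bsub>G\<^esub> g, tgt\<^bsub>G\<^esub> g))"]) auto
  qed
  then show "finite {g \<in> Arr G. psi_inv F g \<noteq> \<zero>\<^bsub>A\<^esub>}"
    by (rule finite_subset) (use F finite_Obj in \<open>simp add: theta_carrier_iff\<close>)
qed (simp add: psi_inv_def)

lemma psi_inv_psi: assumes "f \<in> carrier skew" shows "psi_inv (psi f) = f"
proof
  fix g show "psi_inv (psi f) g = f g"
    using skew_memD(2)[OF assms, of g] by (cases "g \<in> Arr G") (simp_all add: psi_def psi_inv_def)
qed

lemma psi_psi_inv: assumes F: "F \<in> carrier theta_rng" shows "psi (psi_inv F) = F"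
proof (intro ext)
  fix h u
  show "psi (psi_inv F) h u = F h u"
  proof (cases "h \<in> H \<and> u \<in> Obj G \<times> Obj G")
    case True
    then show ?thesis by (cases u) (simp add: psi_def psi_inv_def)
  next
    case False
    have "F h u = \<zero>\<^bsub>A\<^esub>"
    proof (cases "h \<in> H")
      case True
      then have "F h \<in> carrier star"
        using F by (simp add: theta_carrier_iff theta_ideal_iff)
      with True False show ?thesis by (cases u) (auto simp: star_carrier_iff)
    next
      case False
      then show ?thesis using F by (simp add: theta_carrier_iff)
    qed
    with False show ?thesis by (auto simp: psi_def)
  qed
qed

lemma psi_bij: "bij_betw psi (carrier skew) (carrier theta_rng)"
  by (rule bij_betw_byWitness[where f' = psi_inv])
     (auto simp: psi_inv_psi psi_psi_inv psi_closed psi_inv_closed)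


section \<open>Compatibility of \<open>psi\<close> with the operations\<close>

lemma psi_add: "psi (f \<oplus>\<^bsub>skew\<^esub> f') = psi f \<oplus>\<^bsub>theta_rng\<^esub> psi f'"
  by (auto simp: theta_ring_def skew_ring_def[of "isotropy G x"] psi_def fun_eq_iff)

lemma theta_zero: "\<zero>\<^bsub>theta_rng\<^esub> = (\<lambda>_ _. \<zero>\<^bsub>A\<^esub>)"
  by (simp add: theta_ring_def skew_ring_def[of "isotropy G x"])

lemma psi_zero: "psi \<zero>\<^bsub>skew\<^esub> = \<zero>\<^bsub>theta_rng\<^esub>"
  by (auto simp: theta_zero psi_def)

text \<open>After cancellation, the maps of \<open>ginv (\<tau> r)\<close>, \<open>g\<close> and
  \<open>\<tau> z\<close> remain. They fuse into that of \<open>arrow g (r, z)\<close>, because the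
  left factor is a coefficient of \<open>f\<close> from the ideal of this arrow.\<close>

lemma psi_term:
  assumes f: "f \<in> carrier skew" and g: "g \<in> H" and c: "c \<in> carrier star"
  shows "psi f g \<otimes>\<^bsub>star\<^esub> ext_theta g c = (\<lambda>u. if u \<in> Obj G \<times> Obj G
    then finsum A (\<lambda>r. f (arrow g (r, snd u)) \<otimes>\<^bsub>A\<^esub> ext_act (arrow g (r, snd u)) (c (fst u, r))) (Obj G)
    else \<zero>\<^bsub>A\<^esub>)"
proof -
  have "finsum A (\<lambda>r. psi f g (r, z) \<otimes>\<^bsub>A\<^esub> ext_act (\<tau> z) (ext_act (ginv\<^bsub>G\<^esub> (\<tau> r)) (ext_theta g c (y, r)))) (Obj G)
      = finsum A (\<lambda>r. f (arrow g (r, z)) \<otimes>\<^bsub>A\<^esub> ext_act (arrow g (r, z)) (c (y, r))) (Obj G)"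
    if yz: "y \<in> Obj G" "z \<in> Obj G" for y z
  proof (intro finsum_cong' refl)
    fix r assume r: "r \<in> Obj G"
    let ?a = "ext_act g (ext_act (ginv\<^bsub>G\<^esub> (\<tau> r)) (c (y, r)))"
    \<comment> \<open>On \<open>D x\<close> the map of \<open>ginv (\<tau> r)\<close> undoes that of
      \<open>\<tau> r\<close>, the outermost map in \<open>ext_theta\<close>.\<close>
    have "?a \<in> D x"
      using ext_act_in_D[of g] D_subset_x[OF g] g r star_value_closed[OF c] by auto
    then show "psi f g (r, z) \<otimes>\<^bsub>A\<^esub> ext_act (\<tau> z) (ext_act (ginv\<^bsub>G\<^esub> (\<tau> r)) (ext_theta g c (y, r)))
        = f (arrow g (r, z)) \<otimes>\<^bsub>A\<^esub> ext_act (arrow g (r, z)) (c (y, r))"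
      using yz r g mult_ext_act_arrow[of g r z "f (arrow g (r, z))" "c (y, r)"] skew_memD(1)[OF f]
      by (simp add: psi_def ext_theta_def ext_act_ginv_tau_tau star_value_closed[OF c])
  qed (use yz g in \<open>auto simp: mult_closed skew_memD(3)[OF f] star_value_closed[OF c]\<close>)
  then show ?thesis
    by (auto simp: star_mult[OF psi_in_star[OF f] ext_theta_closed[OF g c]])
qed

lemma theta_mult_outside: "k \<notin> H \<Longrightarrow> (F \<otimes>\<^bsub>theta_rng\<^esub> F') k = (\<lambda>_. \<zero>\<^bsub>A\<^esub>)"
proof -
  interpret S: abelian_group star by (rule star_abelian_group)
  assume "k \<notin> H"
  then show ?thesis
    unfolding theta_ring_def skew_ring_def[of "isotropy G x"]
    by (auto simp: isotropy_def simp flip: star_zero intro!: S.add.finprod_one_eqI)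
qed

text \<open>An instance of \<open>finsum_factorizations\<close> for the isotropy group with
  coefficients in \<open>star\<close>. First \<open>identity_of_theta_ideal\<close> and
  \<open>theta_cut\<close> turn the cut followed by \<open>theta\<close> into
  \<open>ext_theta\<close>.\<close>

lemma psi_mult_in_theta:
  assumes f: "f \<in> carrier skew" and f': "f' \<in> carrier skew" and k: "k \<in> H"
  shows "(psi f \<otimes>\<^bsub>theta_rng\<^esub> psi f') k
    = finsum star (\<lambda>g. psi f g \<otimes>\<^bsub>star\<^esub> ext_theta g (psi f' (ginv\<^bsub>G\<^esub> g \<cdot>\<^bsub>G\<^esub> k)))
        (to_isotropy G \<tau> ` {g \<in> Arr G. f g \<noteq> \<zero>\<^bsub>A\<^esub>})"
proof -
  interpret S: abelian_group star by (rule star_abelian_group)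
  let ?I = "isotropy G x"
  interpret I: groupoid ?I by (rule groupoid_isotropy) (rule groupoid_axioms, rule x_Obj)
  have I [simp]: "Arr ?I = H" "src\<^bsub>?I\<^esub> = src\<^bsub>G\<^esub>" "tgt\<^bsub>?I\<^esub> = tgt\<^bsub>G\<^esub>" "cmp ?I = cmp G"
    by (simp_all add: isotropy_def)
  have ginv_I: "ginv\<^bsub>?I\<^esub> g = ginv\<^bsub>G\<^esub> g" if "g \<in> H" for g
    using groupoid_isotropy(2)[OF groupoid_axioms x_Obj that] .
  let ?S = "to_isotropy G \<tau> ` {g \<in> Arr G. f g \<noteq> \<zero>\<^bsub>A\<^esub>}"
  let ?T = "{(g, h). g \<in> Arr ?I \<and> h \<in> Arr ?I \<and> src\<^bsub>?I\<^esub> g = tgt\<^bsub>?I\<^esub> h \<and> g \<cdot>\<^bsub>?I\<^esub> h = k \<and>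
      psi f g \<noteq> \<zero>\<^bsub>star\<^esub> \<and> psi f' h \<noteq> \<zero>\<^bsub>star\<^esub>}"
  let ?F = "\<lambda>g h. psi f g \<otimes>\<^bsub>star\<^esub> ext_theta g (psi f' h)"
  have closed: "?F g h \<in> carrier star" if "g \<in> H" for g h
    using that by (intro star_mult_closed psi_in_star ext_theta_closed f f')
  have "(psi f \<otimes>\<^bsub>theta_rng\<^esub> psi f') k = finsum star (\<lambda>(g, h). psi f g \<otimes>\<^bsub>star\<^esub>
      theta G A D \<alpha> \<tau> g (psi f' h \<otimes>\<^bsub>star\<^esub> identity_of star (theta_ideal G A D \<alpha> \<tau> (ginv\<^bsub>?I\<^esub> g)))) ?T"
    by (simp add: theta_ring_def skew_ring_def[of ?I])
  also have "\<dots> = finsum star (\<lambda>(g, h). ?F g h) ?T"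
    using closed
    by (intro S.finsum_cong') (auto simp: ginv_I identity_of_theta_ideal theta_cut psi_in_star f f')
  also have "\<dots> = finsum star (\<lambda>g. ?F g (ginv\<^bsub>?I\<^esub> g \<cdot>\<^bsub>?I\<^esub> k)) {g \<in> ?S. tgt\<^bsub>?I\<^esub> g = tgt\<^bsub>?I\<^esub> k}"
  proof (rule I.finsum_factorizations)
    \<comment> \<open>The vanishing of products with a zero factor is read off the formula in
      \<open>psi_term\<close> rather than from ring laws of \<open>star\<close>.\<close>
    show "?F g h = \<zero>\<^bsub>star\<^esub>" if "psi f g = \<zero>\<^bsub>star\<^esub>" "g \<in> Arr ?I" for g h
    proof -
      have "f (arrow g u) = \<zero>\<^bsub>A\<^esub>" if "u \<in> Obj G \<times> Obj G" for u
        using fun_cong[OF \<open>psi f g = _\<close>, of u] that \<open>g \<in> _\<close> by (simp add: psi_def)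
      then show ?thesis
        using that by (auto simp: psi_term f psi_in_star f' fun_eq_iff mult_zero_left
            star_value_closed[OF psi_in_star[OF f']] intro!: add.finprod_one_eqI)
    qed
    show "?F g h = \<zero>\<^bsub>star\<^esub>" if "psi f' h = \<zero>\<^bsub>star\<^esub>" "g \<in> Arr ?I" for g h
      using that by (subst psi_term) (auto simp: f psi_in_star f' fun_eq_iff mult_zero_right
            skew_memD(3)[OF f] intro!: add.finprod_one_eqI)
    show "psi f g = \<zero>\<^bsub>star\<^esub>" if "g \<notin> ?S" for g
      using psi_nonzero[of f g] that by auto
    show "finite ?S" using skew_memD(4)[OF f] by simp
  qed (use k closed S.abelian_monoid_axioms in auto)
  \<comment> \<open>The condition on targets is void, as all arrows of the isotropy group end in
    \<open>x\<close>.\<close>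
  also have "{g \<in> ?S. tgt\<^bsub>?I\<^esub> g = tgt\<^bsub>?I\<^esub> k} = ?S"
    using k by auto
  also have "finsum star (\<lambda>g. ?F g (ginv\<^bsub>?I\<^esub> g \<cdot>\<^bsub>?I\<^esub> k)) ?S = finsum star (\<lambda>g. ?F g (ginv\<^bsub>G\<^esub> g \<cdot>\<^bsub>G\<^esub> k)) ?S"
    using closed by (intro S.finsum_cong') (auto simp: ginv_I)
  finally show ?thesis .
qed

lemma arrow_inject:
  assumes "g \<in> H" "y \<in> Obj G" "z \<in> Obj G" "g' \<in> H" "y' \<in> Obj G" "z' \<in> Obj G"
    and eq: "arrow g (y, z) = arrow g' (y', z')"
  shows "g = g'" "y = y'" "z = z'"
  using arg_cong[OF eq, of "to_isotropy G \<tau>"] arg_cong[OF eq, of "source G"] arg_cong[OF eq, of "target G"]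
    assms(1-6) by simp_all

text \<open>Compared at \<open>k\<close> and \<open>(y, z)\<close>: the product in
  \<open>theta_rng\<close> sums over isotropy elements \<open>g\<close> and intermediate objects
  \<open>r\<close>, the product in \<open>skew\<close> over arrows \<open>m\<close> ending in
  \<open>z\<close>. The substitution \<open>m = arrow g (r, z)\<close> identifies the two
  sums.\<close>

lemma psi_mult:
  assumes f: "f \<in> carrier skew" and f': "f' \<in> carrier skew"
  shows "psi (f \<otimes>\<^bsub>skew\<^esub> f') = psi f \<otimes>\<^bsub>theta_rng\<^esub> psi f'"
proof
  interpret S: abelian_group star by (rule star_abelian_group)
  fix k
  show "psi (f \<otimes>\<^bsub>skew\<^esub> f') k = (psi f \<otimes>\<^bsub>theta_rng\<^esub> psi f') k"
  proof (cases "k \<in> H")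
    case False
    then show ?thesis by (simp add: theta_mult_outside) (simp add: psi_def)
  next
    case k: True
    let ?S = "to_isotropy G \<tau> ` {g \<in> Arr G. f g \<noteq> \<zero>\<^bsub>A\<^esub>}"
    let ?F = "\<lambda>g. psi f g \<otimes>\<^bsub>star\<^esub> ext_theta g (psi f' (ginv\<^bsub>G\<^esub> g \<cdot>\<^bsub>G\<^esub> k))"
    have S: "finite ?S" "?S \<subseteq> H" using skew_memD(4)[OF f] by auto
    have closed: "?F g \<in> carrier star" if "g \<in> H" for g
      using that by (intro star_mult_closed psi_in_star ext_theta_closed f f')
    have eval: "(psi f \<otimes>\<^bsub>theta_rng\<^esub> psi f') k u = finsum A (\<lambda>g. ?F g u) ?S" for u
      unfolding psi_mult_in_theta[OF f f' k] using S closed star_value_closed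
      by (intro additive_finsum[where h = "\<lambda>c. c u"])
         (auto simp: S.abelian_monoid_axioms abelian_monoid_axioms)
    show ?thesis
    proof
      fix u
      show "psi (f \<otimes>\<^bsub>skew\<^esub> f') k u = (psi f \<otimes>\<^bsub>theta_rng\<^esub> psi f') k u"
      proof (cases "u \<in> Obj G \<times> Obj G")
        case False
        then have "?F g u = \<zero>\<^bsub>A\<^esub>" if "g \<in> ?S" for g
          using closed[of g] that S(2) by (cases u) (auto simp: star_carrier_iff)
        then have "finsum A (\<lambda>g. ?F g u) ?S = \<zero>\<^bsub>A\<^esub>"
          by (intro add.finprod_one_eqI)
        with False show ?thesis by (simp add: eval) (simp add: psi_def)
      next
        case True
        then obtain y z where u: "u = (y, z)" "y \<in> Obj G" "z \<in> Obj G" by auto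
        \<comment> \<open>Finite because \<open>Obj G\<close> is, and containing the support of
          \<open>f\<close> because each arrow is rebuilt by \<open>arrow\<close> from its isotropy
          part and endpoints; hence admissible in \<open>skew_mult\<close>.\<close>
        let ?M = "(\<lambda>(g, v). arrow g v) ` (?S \<times> (Obj G \<times> Obj G))"
        let ?t = "\<lambda>m. f m \<otimes>\<^bsub>A\<^esub> ext_act m (f' (ginv\<^bsub>G\<^esub> m \<cdot>\<^bsub>G\<^esub> arrow k (y, z)))"
        have t: "?t m \<in> carrier A" if "m \<in> Arr G" for m
          using that by (simp add: mult_closed skew_memD(3)[OF f] skew_memD(3)[OF f'])
        have M: "finite ?M" "?M \<subseteq> Arr G" using S finite_Obj by auto
        have supp: "f m = \<zero>\<^bsub>A\<^esub>" if "m \<in> Arr G" "m \<notin> ?M" for m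
        proof (rule ccontr)
          assume "f m \<noteq> \<zero>\<^bsub>A\<^esub>"
          with that(1) have "m \<in> ?M"
            by (intro image_eqI[of _ _ "(to_isotropy G \<tau> m, (src\<^bsub>G\<^esub> m, tgt\<^bsub>G\<^esub> m))"]) auto
          with that(2) show False ..
        qed
        have "(psi f \<otimes>\<^bsub>theta_rng\<^esub> psi f') k u
            = finsum A (\<lambda>g. finsum A (\<lambda>r. ?t (arrow g (r, z))) (Obj G)) ?S"
          unfolding eval
        proof (intro finsum_cong' refl)
          fix g assume "g \<in> ?S"
          then have g: "g \<in> H" using S by auto
          have "?F g u = finsum A (\<lambda>r. f (arrow g (r, z)) \<otimes>\<^bsub>A\<^esub>
              ext_act (arrow g (r, z)) (psi f' (ginv\<^bsub>G\<^esub> g \<cdot>\<^bsub>G\<^esub> k) (y, r))) (Obj G)"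
            using u by (simp add: psi_term[OF f g psi_in_star[OF f']])
          \<comment> \<open>By \<open>arrow_ginv_cmp\<close>, the entry of \<open>psi f'\<close>
            used here is the coefficient of \<open>f'\<close> at the inverse of
            \<open>arrow g (r, z)\<close> composed with \<open>arrow k (y, z)\<close>.\<close>
          also have "\<dots> = finsum A (\<lambda>r. ?t (arrow g (r, z))) (Obj G)"
          proof (intro finsum_cong' refl)
            show "(\<lambda>r. ?t (arrow g (r, z))) \<in> Obj G \<rightarrow> carrier A"
              using u g t by simp
          qed (use u g k in \<open>simp add: arrow_ginv_cmp psi_def\<close>)
          finally show "?F g u = finsum A (\<lambda>r. ?t (arrow g (r, z))) (Obj G)" .
        qed (use S u t in \<open>auto intro!: finsum_closed\<close>)
        also have "\<dots> = finsum A (\<lambda>(g, r). ?t (arrow g (r, z))) (?S \<times> Obj G)"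
          using S u t finite_Obj by (intro finsum_Sigma) auto
        also have "\<dots> = finsum A (\<lambda>p. ?t (arrow (fst p) (snd p, z))) (?S \<times> Obj G)"
          by (simp add: case_prod_beta')
        also have "\<dots> = finsum A ?t ((\<lambda>p. arrow (fst p) (snd p, z)) ` (?S \<times> Obj G))"
        proof (rule finsum_reindex[symmetric])
          \<comment> \<open>An arrow determines its isotropy part and its source.\<close>
          show "inj_on (\<lambda>p. arrow (fst p) (snd p, z)) (?S \<times> Obj G)"
          proof (rule inj_onI)
            fix p q assume "p \<in> ?S \<times> Obj G" "q \<in> ?S \<times> Obj G"
              and eq: "arrow (fst p) (snd p, z) = arrow (fst q) (snd q, z)"
            then have "fst p \<in> H" "snd p \<in> Obj G" "fst q \<in> H" "snd q \<in> Obj G"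
              using S(2) by auto
            then show "p = q"
              using arrow_inject[OF _ _ u(3) _ _ u(3) eq] by (simp add: prod_eq_iff)
          qed
          show "?t \<in> (\<lambda>p. arrow (fst p) (snd p, z)) ` (?S \<times> Obj G) \<rightarrow> carrier A"
            using S u t by auto
        qed
        also have "(\<lambda>p. arrow (fst p) (snd p, z)) ` (?S \<times> Obj G) = {m \<in> ?M. tgt\<^bsub>G\<^esub> m = tgt\<^bsub>G\<^esub> (arrow k (y, z))}"
          (is "?L = ?R")
        proof
          show "?L \<subseteq> ?R"
          proof
            fix m assume "m \<in> ?L"
            then obtain g r where gr: "m = arrow g (r, z)" "g \<in> ?S" "r \<in> Obj G" by auto
            then have "m \<in> ?M" using u by (intro image_eqI[of _ _ "(g, (r, z))"]) auto
            moreover have "tgt\<^bsub>G\<^esub> m = tgt\<^bsub>G\<^esub> (arrow k (y, z))"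
              using gr subsetD[OF S(2) gr(2)] u k by simp
            ultimately show "m \<in> ?R" by (intro CollectI conjI)
          qed
          show "?R \<subseteq> ?L"
          proof
            fix m assume m: "m \<in> ?R"
            then obtain g r z' where gr: "m = arrow g (r, z')" "g \<in> ?S" "r \<in> Obj G" "z' \<in> Obj G" by auto
            moreover have "tgt\<^bsub>G\<^esub> m = z" using m u k by simp
            ultimately have "z' = z" using subsetD[OF S(2) gr(2)] by simp
            then show "m \<in> ?L" using gr by (intro image_eqI[of _ _ "(g, r)"]) auto
          qed
        qed
        also have "finsum A ?t \<dots> = (f \<otimes>\<^bsub>skew\<^esub> f') (arrow k (y, z))"
          using u k M by (intro skew_mult[symmetric] f f' supp) auto
        finally show ?thesis
          using u k by (simp add: psi_def)
      qed
    qed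
  qed
qed

section \<open>From the reindexing map to \<open>phi\<close>\<close>

lemma psi_isomorphism: "ring_isomorphism skew theta_rng psi"
  by (intro ring_isomorphism_transport skew_nonunital_ring psi_bij psi_zero psi_add psi_mult)

lemma psi_delta:
  assumes "g \<in> Arr G"
  shows "psi (delta A a g) = phi_gen G A D \<alpha> \<tau> a g"
proof (intro ext)
  fix h u
  \<comment> \<open>Exactly one position reads the coefficient at \<open>g\<close>, since
    \<open>arrow\<close> and passage to isotropy part and endpoints are mutually inverse.\<close>
  have "arrow h u = g \<longleftrightarrow> h = to_isotropy G \<tau> g \<and> u = (src\<^bsub>G\<^esub> g, tgt\<^bsub>G\<^esub> g)"
    if "h \<in> H" "u \<in> Obj G \<times> Obj G"
    using that assms by (cases u) auto
  then show "psi (delta A a g) h u = phi_gen G A D \<alpha> \<tau> a g h u"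
    using assms by (auto simp: psi_def phi_gen_def delta_def)
qed

text \<open>\<open>phi\<close> adds up the prescribed images of the homogeneous terms of
  \<open>f\<close>. These are also their images under the additive map \<open>psi\<close>, and by
  \<open>skew_expansion\<close> the terms add up to \<open>f\<close>.\<close>

lemma phi_eq_psi:
  assumes f: "f \<in> carrier skew"
  shows "phi G A D \<alpha> x \<tau> f = psi f"
proof -
  interpret I: ring_isomorphism skew theta_rng psi by (rule psi_isomorphism)
  let ?S = "{g \<in> Arr G. f g \<noteq> \<zero>\<^bsub>A\<^esub>}"
  have "phi G A D \<alpha> x \<tau> f = finsum theta_rng (\<lambda>g. psi (delta A (f g) g)) ?S"
    unfolding phi_def using f
    by (intro I.S.finsum_cong') (auto simp: psi_delta[symmetric] intro!: psi_closed delta_in_skew skew_memD(1))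
  also have "\<dots> = psi (finsum skew (\<lambda>g. delta A (f g) g) ?S)"
    using f skew_memD(4)[OF f]
    by (intro additive_finsum[symmetric, where h = psi and F = "\<lambda>g. delta A (f g) g"] I.R.abelian_monoid_axioms I.S.abelian_monoid_axioms psi_zero psi_add)
       (auto intro!: psi_closed delta_in_skew skew_memD(1))
  finally show ?thesis
    by (simp only: skew_expansion[OF f])
qed

lemma phi_isomorphism: "ring_isomorphism skew theta_rng (phi G A D \<alpha> x \<tau>)"
proof -
  interpret I: ring_isomorphism skew theta_rng psi by (rule psi_isomorphism)
  show ?thesis
    using psi_bij
    by unfold_locales
      (auto simp: phi_eq_psi I.hom_add I.hom_mult skew_mult_closed I.R.a_closed simp del: skew_add cong: bij_betw_cong)
qed

end

theorem theorem5p4: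
  fixes G :: "'g groupoid" and A :: "('a, 'm) ring_scheme"
    and D :: "'g \<Rightarrow> 'a set" and \<alpha> :: "'g \<Rightarrow> 'a \<Rightarrow> 'a"
    and x :: 'g and \<tau> :: "'g \<Rightarrow> 'g"
  assumes "connected_groupoid G"
    and "finite (Obj G)"
    and "x \<in> Obj G"
    and "transversal G x \<tau>"
    and "unital_partial_action G A D \<alpha>"
    and "transversal_global G D x \<tau>"
  shows "ring_isomorphism (skew_ring G A D \<alpha>) (theta_ring G A D \<alpha> x \<tau>) (phi G A D \<alpha> x \<tau>) \<and>
    (\<forall>g\<in>Arr G. \<forall>a\<in>D g. phi G A D \<alpha> x \<tau> (delta A a g) =
       delta (star_ring G A D \<alpha> \<tau>) (delta A a (src\<^bsub>G\<^esub> g, tgt\<^bsub>G\<^esub> g)) (to_isotropy G \<tau> g))"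
proof -
  interpret unital_partial_action G A D \<alpha> by fact
  interpret global_transversal G A D \<alpha> x \<tau>
    by unfold_locales (fact assms)+
  have "phi G A D \<alpha> x \<tau> (delta A a g) =
      delta (star_ring G A D \<alpha> \<tau>) (delta A a (src\<^bsub>G\<^esub> g, tgt\<^bsub>G\<^esub> g)) (to_isotropy G \<tau> g)"
    if "g \<in> Arr G" "a \<in> D g" for g a
    using that by (simp add: phi_eq_psi delta_in_skew psi_delta) (simp add: phi_gen_def)
  with phi_isomorphism show ?thesis by blast
qed

end
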